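(* Let $\mathcal{P}$ be a rank $5$ abstract regular polytope for the Mathieu group $\mathrm{M}_{24}$ (that is, an abstract regular polytope of rank $5$ with automorphism group isomorphic to $\mathrm{M}_{24}$; equivalently, a C-string $(t_1,t_2,t_3,t_4,t_5)$ for $\mathrm{M}_{24}$). (i) If $\mathcal{P}$ has Schläfli symbol $[4,10,3,4]$, then the chamber graph of $\mathcal{P}$ has diameter at most $127$. (ii) If $\mathcal{P}$ has Schläfli symbol $[4,10,3,3]$, then the chamber graph of $\mathcal{P}$ has diameter at most $133$.
   Context: A set of involutions $\{t_1,\dots,t_n\}$ (with its given ordering) is a C-string for a group $G$ if $t_1,\dots,t_n$ generate $G$ and, with $I=\{1,\dots,n\}$: (a) $t_it_j=t_jt_i$ for all $i,j\in I$ with $|i-j|\ge 2$; and (b) $G_J\cap G_K=G_{J\cap K}$ for all $J,K\subseteq I$, where $G_J=\langle t_i\mid i\in J\rangle$ for $\emptyset\ne J\subseteq I$ and $G_\emptyset=1$. Abstract regular polytopes of rank $n$ with automorphism group $G$ and C-strings of $n$ involutions for $G$ are equivalent formulations. The Schläfli symbol of the polytope corresponding to $\{t_1,\dots,t_n\}$ is $[p_1,\dots,p_{n-1}]$, where $p_i$ is the order of $t_it_{i+1}$. The chamber graph of the polytope corresponding to the C-string $\{t_1,\dots,t_n\}$ is the Cayley graph of $G$ with respect to the generating set $\{t_1,\dots,t_n\}$. $\mathrm{M}_{24}$ is the Mathieu group of degree $24$, of order $244{,}823{,}040$. *)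

theory Defs
  imports
    "HOL-Algebra.Sym_Groups"
    "HOL-Algebra.Multiplicative_Group"
    "HOL-Number_Theory.Residues"
    "Graph_Theory.Pair_Digraph"
    "Graph_Theory.Shortest_Path"
begin

text \<open>The Mathieu group \<open>M\<^sub>2\<^sub>4\<close> is taken to be the automorphism group of the extended binary
  Golay code, realised as the extended quadratic residue code modulo 23. The 24 points form the
  projective line over the field with 23 elements: \<open>1, \<dots>, 23\<close> stand for the residues modulo 23
  (with 23 in the role of 0), and 24 stands for the point at infinity. Codewords are identified
  with their supports, so that addition of codewords is symmetric difference.\<close>

definition golay_word :: "nat \<Rightarrow> nat set" where
  "golay_word i = insert 24 {x \<in> {1..23}. Legendre (int x - int i) 23 = 1}"

inductive_set golay_code :: "nat set set" where
  zero: "{} \<in> golay_code"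
| add: "X \<in> golay_code \<Longrightarrow> i \<in> {1..23} \<Longrightarrow> sym_diff X (golay_word i) \<in> golay_code"

definition M24 :: "(nat \<Rightarrow> nat) monoid" where
  "M24 = (sym_group 24)
     \<lparr>carrier := {p. p permutes {1..24} \<and> (\<lambda>X. p ` X) ` golay_code = golay_code}\<rparr>"

lemma group_M24: "group M24"
proof -
  let ?A = "{p. p permutes {1..24::nat} \<and> (\<lambda>X. p ` X) ` golay_code = golay_code}"
  interpret S: group "sym_group 24" by (rule sym_group_is_group)
  have "subgroup ?A (sym_group 24)"
  proof (rule S.subgroupI)
    show "?A \<subseteq> carrier (sym_group 24)" by (auto simp: sym_group_def)
    have "id \<in> ?A" by (auto simp: permutes_id)
    then show "?A \<noteq> {}" by blast
  next
    fix p assume p: "p \<in> ?A"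
    then have perm: "p permutes {1..24}" by simp
    have inv: "inv\<^bsub>sym_group 24\<^esub> p = inv_into UNIV p"
      using perm permutes_inv[OF perm] permutes_inv_o[OF perm]
      by (intro S.inv_equality) (auto simp: sym_group_def)
    have "(\<lambda>X. inv_into UNIV p ` X) ` (\<lambda>X. p ` X) ` golay_code = golay_code"
      using permutes_inj[OF perm] by (simp add: image_comp)
    then show "inv\<^bsub>sym_group 24\<^esub> p \<in> ?A"
      using p permutes_inv[OF perm] by (simp add: inv)
  next
    fix p q assume "p \<in> ?A" "q \<in> ?A"
    moreover have "(\<lambda>X. (p \<circ> q) ` X) ` golay_code
        = (\<lambda>X. p ` X) ` (\<lambda>X. q ` X) ` golay_code"
      by (auto simp: image_comp)
    ultimately show "p \<otimes>\<^bsub>sym_group 24\<^esub> q \<in> ?A"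
      by (simp add: sym_group_def permutes_compose)
  qed
  then show ?thesis
    unfolding M24_def by (rule S.subgroup_imp_group)
qed

text \<open>Note that \<open>generate G {} = {\<one>}\<close>, so \<open>generate G (t ` J)\<close> is the subgroup \<open>G\<^sub>J\<close> also for
  empty \<open>J\<close>.\<close>

definition C_string :: "('a, 'b) monoid_scheme \<Rightarrow> nat \<Rightarrow> (nat \<Rightarrow> 'a) \<Rightarrow> bool" where
  "C_string G n t \<longleftrightarrow>
     (\<forall>i\<in>{1..n}. t i \<in> carrier G \<and> group.ord G (t i) = 2) \<and>
     generate G (t ` {1..n}) = carrier G \<and>
     (\<forall>i\<in>{1..n}. \<forall>j\<in>{1..n}. \<bar>int i - int j\<bar> \<ge> 2 \<longrightarrow> t i \<otimes>\<^bsub>G\<^esub> t j = t j \<otimes>\<^bsub>G\<^esub> t i) \<and>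
     (\<forall>J K. J \<subseteq> {1..n} \<longrightarrow> K \<subseteq> {1..n} \<longrightarrow>
        generate G (t ` J) \<inter> generate G (t ` K) = generate G (t ` (J \<inter> K)))"

definition schlaefli_symbol :: "('a, 'b) monoid_scheme \<Rightarrow> nat \<Rightarrow> (nat \<Rightarrow> 'a) \<Rightarrow> nat list" where
  "schlaefli_symbol G n t = map (\<lambda>i. group.ord G (t i \<otimes>\<^bsub>G\<^esub> t (Suc i))) [1..<n]"

definition cayley_graph :: "('a, 'b) monoid_scheme \<Rightarrow> 'a set \<Rightarrow> 'a pair_pre_digraph" where
  "cayley_graph G S =
     \<lparr>pverts = carrier G, parcs = {(g, g \<otimes>\<^bsub>G\<^esub> s) | g s. g \<in> carrier G \<and> s \<in> S}\<rparr>"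

definition chamber_graph :: "('a, 'b) monoid_scheme \<Rightarrow> nat \<Rightarrow> (nat \<Rightarrow> 'a) \<Rightarrow> 'a pair_pre_digraph" where
  "chamber_graph G n t = cayley_graph G (t ` {1..n})"

text \<open>The function \<open>wf_digraph.\<mu>\<close> with unit weights is the usual graph distance (the least
  length of a walk), with value \<open>\<infinity>\<close> if there is no walk.\<close>

definition diameter :: "('a, 'b) pre_digraph \<Rightarrow> ereal" where
  "diameter \<Gamma> = (SUP u\<in>verts \<Gamma>. SUP v\<in>verts \<Gamma>. wf_digraph.\<mu> \<Gamma> (\<lambda>_. 1) u v)"

lemma (in group) wf_digraph_cayley_graph:
  assumes "S \<subseteq> carrier G"
  shows "wf_digraph (with_proj (cayley_graph G S))"
  using assms by unfold_locales (auto simp: cayley_graph_def)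

lemma (in group) wf_digraph_chamber_graph:
  assumes "C_string G n t"
  shows "wf_digraph (with_proj (chamber_graph G n t))"
  using assms unfolding chamber_graph_def
  by (intro wf_digraph_cayley_graph) (auto simp: C_string_def)

lemma (in group) symmetric_chamber_graph:
  assumes "C_string G n t"
  shows "symmetric (with_proj (chamber_graph G n t))"
proof -
  have *: "(g \<otimes> t i, g) \<in> parcs (chamber_graph G n t)"
    if "g \<in> carrier G" "i \<in> {1..n}" for g i
  proof -
    have ti: "t i \<in> carrier G" "ord (t i) = 2"
      using assms that by (auto simp: C_string_def)
    have "t i \<otimes> t i = \<one>"
      using pow_ord_eq_1[OF ti(1)] ti by (simp add: numeral_2_eq_2)
    then have "g = (g \<otimes> t i) \<otimes> t i"
      using that ti by (simp add: m_assoc)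
    then show ?thesis
      using that ti by (fastforce simp: chamber_graph_def cayley_graph_def)
  qed
  then show ?thesis
    by (auto simp: symmetric_def sym_def chamber_graph_def cayley_graph_def)
qed

end

theory Submission
  imports Defs
begin

text \<open>Up to conjugation in the Mathieu group there is exactly one C-string for each of the two
  symbols. To see this, note that \<open>a = t\<^sub>2 t\<^sub>3\<close> has order 10 and has a cycle of length at least 5;
  by 5-transitivity five consecutive points of the cycle can be prescribed, which leaves 48
  candidates for each image of the last one. Those of order 10 turn out to be conjugate. Then \<open>t\<^sub>5\<close>
  is an involution in the centraliser of \<open>a\<close>, a group of order 20, and \<open>t\<^sub>2\<close> inverts \<open>a\<close>, so that
  there remain two choices for \<open>t\<^sub>5\<close> and four for \<open>t\<^sub>2\<close>. For each of them \<open>t\<^sub>4\<close> is found by a search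
  among the involutions commuting with \<open>t\<^sub>2\<close>, and \<open>t\<^sub>1\<close>, which commutes with \<open>t\<^sub>3\<close>, \<open>t\<^sub>4\<close> and \<open>t\<^sub>5\<close>,
  is determined by the image of a single point. The solutions that do not generate the whole group
  are excluded by the intersection property.

  For the two C-strings a stabiliser chain with short words as coset representatives shows that
  every group element is a word of length at most 92 or 96, respectively. Such a chain also proves
  5-transitivity, and the minimum distance of the Golay code and the structure of the stabiliser of
  five points follow from it.\<close>

section \<open>Evaluation of permutations\<close>

text \<open>\<open>M24\<close> is given only as the stabiliser of the code, so its order and
  transitivity have to be established as well. Explicit words supply enough elements. The upper
  bound comes from octads: two octads sharing five points coincide, so an element fixing the five
  base points preserves the octad through them; it can move 4 to at most 16 points and then 7 to at
  most 3, and an element fixing all seven is trivial. Hence an element is given by the images of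
  five points and one of 16 * 3 = 48 tables, and each step of the search becomes the question which
  elements take five or more prescribed values. The relations between the generators turn a few
  guessed images into that many values. The group \<open>G\<close> enters through a finite list of
  equations and inequations between words, \<open>good\<close>, which an isomorphism to
  \<open>M24\<close> and conjugation there preserve; word lengths are preserved too, so the bound
  for the standard strings carries over. It is the sum of the length bounds of the seven levels:
  7+18+5+13+15+21+13 = 92 and 9+20+5+13+15+21+13 = 96.\<close>

primrec elem :: "'a \<Rightarrow> 'a list \<Rightarrow> bool" where
  "elem x [] = False"
| "elem x (y # ys) = (x = y \<or> elem x ys)"

lemma elem_iff [simp]: "elem x ys \<longleftrightarrow> x \<in> set ys"
  by (induction ys) auto

text \<open>Positions are counted from 1, so that a list of length 24 with entries in \<open>{1..24}\<close> is the
  table of a permutation of the 24 points.\<close>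

definition entry :: "'a list \<Rightarrow> nat \<Rightarrow> 'a" where
  "entry xs n = xs ! (n - 1)"

definition act :: "nat list \<Rightarrow> nat \<Rightarrow> nat" where
  "act p x = (if x \<in> {1..length p} then entry p x else x)"

definition pcomp :: "nat list \<Rightarrow> nat list \<Rightarrow> nat list" where
  "pcomp p q = map (act p) q"

definition pts :: "nat list" where
  "pts = [1,2,3,4,5,6,7,8,9,10,11,12,13,14,15,16,17,18,19,20,21,22,23,24]"

text \<open>The leftmost letter acts last in all three evaluations: \<open>wtab\<close> yields a
  table, \<open>run\<close> follows a single point, and \<open>wfun\<close> is the meaning of a word
  for arbitrary maps.\<close>

primrec wtab :: "nat list list \<Rightarrow> nat list \<Rightarrow> nat list" where
  "wtab ts [] = pts"
| "wtab ts (i # w) = pcomp (entry ts i) (wtab ts w)"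

primrec run :: "nat list list \<Rightarrow> nat list \<Rightarrow> nat \<Rightarrow> nat" where
  "run ts [] x = x"
| "run ts (i # w) x = act (entry ts i) (run ts w x)"

primrec wfun :: "(nat \<Rightarrow> nat \<Rightarrow> nat) \<Rightarrow> nat list \<Rightarrow> nat \<Rightarrow> nat" where
  "wfun s [] = id"
| "wfun s (i # w) = s i \<circ> wfun s w"

text \<open>Lookup rules for the simplifier: one rewrite step per lookup, instead of a recursion
  along the index.\<close>

lemma entry_24:
  fixes x1 x2 x3 x4 x5 x6 x7 x8 x9 x10 x11 x12 x13 x14 x15 x16 x17 x18 x19 x20 x21 x22 x23 x24 :: 'a
  defines "xs \<equiv> [x1, x2, x3, x4, x5, x6, x7, x8, x9, x10, x11, x12, x13, x14, x15, x16, x17, x18,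
    x19, x20, x21, x22, x23, x24]"
  shows
    "entry xs 1 = x1"
    "entry xs 2 = x2"
    "entry xs 3 = x3"
    "entry xs 4 = x4"
    "entry xs 5 = x5"
    "entry xs 6 = x6"
    "entry xs 7 = x7"
    "entry xs 8 = x8"
    "entry xs 9 = x9"
    "entry xs 10 = x10"
    "entry xs 11 = x11"
    "entry xs 12 = x12"
    "entry xs 13 = x13"
    "entry xs 14 = x14"
    "entry xs 15 = x15"
    "entry xs 16 = x16"
    "entry xs 17 = x17"
    "entry xs 18 = x18"
    "entry xs 19 = x19"
    "entry xs 20 = x20"
    "entry xs 21 = x21"
    "entry xs 22 = x22"
    "entry xs 23 = x23"
    "entry xs 24 = x24"
  by (simp_all add: xs_def entry_def)

lemma act_24:
  fixes x1 x2 x3 x4 x5 x6 x7 x8 x9 x10 x11 x12 x13 x14 x15 x16 x17 x18 x19 x20 x21 x22 x23 x24 ::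
    nat
  defines "xs \<equiv> [x1, x2, x3, x4, x5, x6, x7, x8, x9, x10, x11, x12, x13, x14, x15, x16, x17, x18,
    x19, x20, x21, x22, x23, x24]"
  shows
    "act xs 1 = x1"
    "act xs 2 = x2"
    "act xs 3 = x3"
    "act xs 4 = x4"
    "act xs 5 = x5"
    "act xs 6 = x6"
    "act xs 7 = x7"
    "act xs 8 = x8"
    "act xs 9 = x9"
    "act xs 10 = x10"
    "act xs 11 = x11"
    "act xs 12 = x12"
    "act xs 13 = x13"
    "act xs 14 = x14"
    "act xs 15 = x15"
    "act xs 16 = x16"
    "act xs 17 = x17"
    "act xs 18 = x18"
    "act xs 19 = x19"
    "act xs 20 = x20"
    "act xs 21 = x21"
    "act xs 22 = x22"
    "act xs 23 = x23"
    "act xs 24 = x24"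
  by (simp_all add: xs_def act_def entry_def)

lemma pcomp_24: "pcomp p [x1, x2, x3, x4, x5, x6, x7, x8, x9, x10, x11, x12, x13, x14, x15, x16,
  x17, x18, x19, x20, x21, x22, x23, x24] = [act p x1, act p x2, act p x3, act p x4, act p x5, act p
  x6, act p x7, act p x8, act p x9, act p x10, act p x11, act p x12, act p x13, act p x14, act p
  x15, act p x16, act p x17, act p x18, act p x19, act p x20, act p x21, act p x22, act p x23, act p
  x24]"
  by (simp add: pcomp_def)

lemma entry_5:
  shows "entry [x1, x2, x3, x4, x5] 1 = x1" "entry [x1, x2, x3, x4, x5] 2 = x2" "entry [x1, x2, x3,
    x4, x5] 3 = x3" "entry [x1, x2, x3, x4, x5] 4 = x4" "entry [x1, x2, x3, x4, x5] 5 = x5"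
  by (simp_all add: entry_def)

text \<open>All computations are done by rewriting with \<open>simp only\<close>. These congruence rules impose an
  evaluation order: a condition or a list is evaluated first, and bodies of functions only after
  they have received an explicit argument. Without them both branches of a conditional would be
  rewritten, at exponential cost.\<close>

lemma weak_congs:
  "a = a' \<Longrightarrow> (if a then x else y) = (if a' then x else y)"
  "a = a' \<Longrightarrow> (a \<and> b) = (a' \<and> b)"
  "a = a' \<Longrightarrow> (a \<or> b) = (a' \<or> b)"
  "a = a' \<Longrightarrow> (a \<longrightarrow> b) = (a' \<longrightarrow> b)"
  "x = x' \<Longrightarrow> Let x f = Let x' f"
  "ys = ys' \<Longrightarrow> list_all P ys = list_all P ys'"
  "ys = ys' \<Longrightarrow> list_ex P ys = list_ex P ys'"
  "ys = ys' \<Longrightarrow> map g ys = map g ys'"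
  "ys = ys' \<Longrightarrow> filter P ys = filter P ys'"
  by simp_all

lemmas basic_eval =
  if_True if_False simp_thms Let_def prod.case fst_conv snd_conv list.map list.pred_inject
    list_ex_Nil_iff list_ex_Cons_iff
  filter.simps append.simps rev.simps elem.simps list.inject list.distinct
  num.inject num.distinct numeral_eq_iff one_eq_numeral_iff numeral_eq_one_iff refl
  entry_24 act_24 entry_5 pcomp_24 pts_def wtab.simps run.simps


text \<open>The first four generators together with the fifth or the sixth one form a C-string with symbol
  \<open>[4,10,3,4]\<close> or \<open>[4,10,3,3]\<close>, found by a computer search. In both cases the first four generate
  the stabiliser of the pair \<open>{15,22}\<close>.\<close>

definition gens :: "nat list list" where
  "gens = [
   [1,12,21,14,6,5,11,18,9,13,7,2,10,4,22,16,17,8,19,20,3,15,23,24],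
   [11,2,3,4,9,23,24,19,5,16,1,12,20,14,15,10,18,17,8,13,21,22,6,7],
   [9,12,6,13,21,3,11,18,1,14,7,2,4,10,22,24,20,8,23,17,5,15,19,16],
   [24,14,21,12,18,8,11,6,17,13,7,4,10,2,22,20,9,5,23,16,3,15,19,1],
   [17,15,14,21,13,10,8,7,20,6,18,22,5,3,2,23,1,11,24,9,4,12,16,19],
   [19,22,21,14,6,5,18,11,23,13,8,15,10,4,12,20,24,7,1,16,3,2,9,17]]"


text \<open>The list enters through an equation so that the rules, instantiated with a definition,
  apply to a constant such as \<open>gens\<close> without unfolding it.\<close>

lemma entry_6_def:
  assumes "xs = [x1, x2, x3, x4, x5, x6]"
  shows "entry xs 1 = x1" "entry xs 2 = x2" "entry xs 3 = x3" "entry xs 4 = x4" "entry xs 5 = x5"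
    "entry xs 6 = x6"
  using assms by (simp_all add: entry_def)

lemmas gens_eval = entry_6_def[OF gens_def]

definition fw :: "nat list list \<Rightarrow> nat \<Rightarrow> nat list" where
  "fw W y = wtab gens (entry W y)"

definition bk :: "nat list list \<Rightarrow> nat \<Rightarrow> nat list" where
  "bk W y = wtab gens (rev (entry W y))"

lemma fw_24:
  assumes "W = [x1, x2, x3, x4, x5, x6, x7, x8, x9, x10, x11, x12, x13, x14, x15, x16, x17, x18,
    x19, x20, x21, x22, x23, x24]"
  shows
    "fw W 1 = wtab gens x1"
    "fw W 2 = wtab gens x2"
    "fw W 3 = wtab gens x3"
    "fw W 4 = wtab gens x4"
    "fw W 5 = wtab gens x5"
    "fw W 6 = wtab gens x6"
    "fw W 7 = wtab gens x7"
    "fw W 8 = wtab gens x8"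
    "fw W 9 = wtab gens x9"
    "fw W 10 = wtab gens x10"
    "fw W 11 = wtab gens x11"
    "fw W 12 = wtab gens x12"
    "fw W 13 = wtab gens x13"
    "fw W 14 = wtab gens x14"
    "fw W 15 = wtab gens x15"
    "fw W 16 = wtab gens x16"
    "fw W 17 = wtab gens x17"
    "fw W 18 = wtab gens x18"
    "fw W 19 = wtab gens x19"
    "fw W 20 = wtab gens x20"
    "fw W 21 = wtab gens x21"
    "fw W 22 = wtab gens x22"
    "fw W 23 = wtab gens x23"
    "fw W 24 = wtab gens x24"
  using assms by (simp_all only: fw_def entry_24)

lemma bk_24:
  assumes "W = [x1, x2, x3, x4, x5, x6, x7, x8, x9, x10, x11, x12, x13, x14, x15, x16, x17, x18,
    x19, x20, x21, x22, x23, x24]"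
  shows
    "bk W 1 = wtab gens (rev x1)"
    "bk W 2 = wtab gens (rev x2)"
    "bk W 3 = wtab gens (rev x3)"
    "bk W 4 = wtab gens (rev x4)"
    "bk W 5 = wtab gens (rev x5)"
    "bk W 6 = wtab gens (rev x6)"
    "bk W 7 = wtab gens (rev x7)"
    "bk W 8 = wtab gens (rev x8)"
    "bk W 9 = wtab gens (rev x9)"
    "bk W 10 = wtab gens (rev x10)"
    "bk W 11 = wtab gens (rev x11)"
    "bk W 12 = wtab gens (rev x12)"
    "bk W 13 = wtab gens (rev x13)"
    "bk W 14 = wtab gens (rev x14)"
    "bk W 15 = wtab gens (rev x15)"
    "bk W 16 = wtab gens (rev x16)"
    "bk W 17 = wtab gens (rev x17)"
    "bk W 18 = wtab gens (rev x18)"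
    "bk W 19 = wtab gens (rev x19)"
    "bk W 20 = wtab gens (rev x20)"
    "bk W 21 = wtab gens (rev x21)"
    "bk W 22 = wtab gens (rev x22)"
    "bk W 23 = wtab gens (rev x23)"
    "bk W 24 = wtab gens (rev x24)"
  using assms by (simp_all only: bk_def entry_24)

text \<open>The base is \<open>15, 22, 17, 24, 14, 4, 7\<close>. Entry \<open>y\<close> of the \<open>k\<close>-th list below is a word in the
  generators that fixes the first \<open>k - 1\<close> base points and maps the \<open>k\<close>-th one to \<open>y\<close>; it is the
  empty word where no such element exists. The words in \<open>W1'\<close> and \<open>W2'\<close> use the sixth generator
  instead of the fifth.\<close>

definition W1 :: "nat list list" where
  "W1 = [
   [4,3,2,3,4,5], [5], [5,4,5], [4,5,1], [5,3,4,5,1], [5,3,4,5], [2,3,2,3,4,5], [4,5,3,4,5],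
   [5,2,3,4,5,1], [3,4,5], [5,4,5,3,4,5,1], [5,1], [3,4,5,1], [4,5], [], [2,3,4,5], [3,2,3,4,5,1],
   [4,5,3,4,5,1], [5,3,2,3,4,5], [2,3,4,5,1], [5,4,5,1], [1], [5,2,3,4,5], [3,2,3,4,5]]"

text \<open>The words are multiplied out once, here; afterwards \<open>fw W1 y\<close> rewrites to a
  finished table in one step.\<close>

lemmas W1_eval =
  fw_24[OF W1_def, unfolded basic_eval gens_eval]
  bk_24[OF W1_def, unfolded basic_eval gens_eval]

definition W2 :: "nat list list" where
  "W2 = [
   [4,5,3,4,5,1,2,3,4,2,3,2,3,4,5,1], [4,5,3,4,5,2,1,2,3,4,2,3,2,3,4,5,1],
   [3,4,5,4,2,3,2,3,2,3,4,2,3,2,3,4,5], [5,3,4,5,2,1,2,3,4,5,2,3,2,3,4,5],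
   [4,5,2,3,4,5,2,3,4,5,2,3,2,3,4,5], [4,5,4,2,3,1,2,3,2,3,4,2,3,2,3,4,5],
   [5,2,3,4,5,2,3,4,2,3,2,3,4,5,1], [5,4,2,3,2,3,2,3,4,2,3,2,3,4,5],
   [4,5,3,4,5,2,3,4,5,2,3,2,3,4,5], [5,4,5,2,1,2,3,4,2,3,2,3,4,5,1],
   [5,1,2,3,4,5,1,2,3,4,2,3,2,3,4,5,1], [4,5,4,3,2,3,4,5,2,3,4,5,1], [5,4,5,3,4,5,2,3,2,3,4,5],
   [5,4,5,3,2,3,4,5,2,3,4,5], [], [5,4,5,1,2,3,4,2,3,2,3,4,5,1], [5,3,4,5,1,2,3,4,5,2,3,2,3,4,5],
   [5,2,3,4,5,1,2,3,4,5,2,3,2,3,4,5], [5,4,3,2,3,2,3,4,2,3,2,3,4,5], [5,4,5,2,3,4,5,2,3,2,3,4,5],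
   [3,4,5,2,3,4,5,1,2,3,4,5,2,3,2,3,4,5], [], [5,3,4,3,1,2,3,2,3,4,2,3,2,3,4,5],
   [5,3,4,5,2,3,4,2,3,2,3,4,5,1]]"

lemmas W2_eval =
  fw_24[OF W2_def, unfolded basic_eval gens_eval]
  bk_24[OF W2_def, unfolded basic_eval gens_eval]

text \<open>From here on the letters 1 to 4 suffice, because the elements fixing 15 and 22 lie in
  the group generated by the first four generators. So \<open>W3\<close> to \<open>W7\<close> serve
  both C-strings.\<close>

definition W3 :: "nat list list" where
  "W3 = [
   [3,4], [1,4,3,2,3], [3,4,3,2,1], [3,2,3], [2,1,4], [1,2,4], [1,2,1,3,4], [1,2,1], [1,4],
   [1,2,3], [2,3,4], [4,3,2,1,3], [2,1,3], [1,3,2,1,3], [], [4,3], [], [2], [1,2,3,2], [1,3],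
   [3,2,4], [], [2,1,2,4], [1,3,4,3]]"

lemmas W3_eval =
  fw_24[OF W3_def, unfolded basic_eval gens_eval]
  bk_24[OF W3_def, unfolded basic_eval gens_eval]

definition W4 :: "nat list list" where
  "W4 = [
   [2,1,4,3,2,1,2,3,2,4], [2,3,2,3,4,3,2,1,3,2,3,2,4], [2,1,2,3,2,3,2,1,3,2,4],
   [1,2,3,2,1,3,2,4,3,2], [1,2,3,2,1,2,3,4,3,2,3,2,4], [2,1,3,2,3,4,3,2,3,2,3,4],
   [2,1,3,2,1,2,4,3,2,3,2,1,4], [4,3,2,1,3,2,3,4], [2,3,2,3,2,3,2,3,4,3,2], [1,2,4,3,2,3,2,1,4],
   [1,2,1,3,2,1,2,4,3,2,3,2,4], [3,2,1,2,3,4,3,2,3,2,3,2,4], [2,4,3,2,3,2,4], [2,3,2,3,2,4,3,2],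
   [], [2,3,2,3,2,1,3,2,3,2,4], [], [2,1,4,3,2,1,3,2,4], [2,3,2,4,3,2,1,2], [2,1,2,3,2,1,2,4],
   [3,2,1,2,3,2,3,2,3,4], [], [1,4,3,2,3,2,1,2,3,2,3,4], []]"

lemmas W4_eval =
  fw_24[OF W4_def, unfolded basic_eval gens_eval]
  bk_24[OF W4_def, unfolded basic_eval gens_eval]

definition W5 :: "nat list list" where
  "W5 = [
   [3,2,1,4,3,2,1,3,2,4,3], [3,2,3,4,3,2,1,3,2,3,2,4,3,2,3], [3,2,3,2,1,2,3,2,4,3], [3,2,1,2,4,3],
   [2,1,2,3,2,3,2,1,4,3,2,3,2,1,2], [2,1,3,2,3,2,4,3,2,1,2,3,2,3], [2,1,2,3,2,1,3,4,3,2,3,2,1,2],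
   [3,2,4,3,2,1,2,3,2,3], [3,2,3,2,3,2,3], [2,3,2,3,2,1,3,4,3,2,3,2,1,2],
   [2,3,2,3,2,3,2,1,4,3,2,3,2,1,2], [3,2,1,3,4,3,2,3,2,3,2,4,3,2,3], [3,2,3,2,3,4,3,2,1,2,3,2,3],
   [], [], [1,2,1,3,2,1], [], [3,2,1,4,3,2,1,2,3,2,4,3], [3,2,4,3,2,3,2,4,3], [2,1,3,2],
   [3,2,1,3,2,1,2,3,2,3], [], [3,2,3,2,1,3,2,4,3], []]"

lemmas W5_eval =
  fw_24[OF W5_def, unfolded basic_eval gens_eval]
  bk_24[OF W5_def, unfolded basic_eval gens_eval]

definition W6 :: "nat list list" where
  "W6 = [
   [3,2,3,2,1,3,4,3,2,3,2,3], [3,2,3,4,3,2,3,2,3,2,3,4,3,2,3], [3,2,1,3,2,4,3,2,1,2,3,2,4,3,2,3],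
   [], [1,3,2,3,2,3,2,1,2,3,4,3,2,3,2,1,3,4,3,2,3], [2,1,3,2,3,2,1,3,4,3,2,3,2,3,4,3,2,3], [],
   [2,3,2,1,3,2,1,3,4,3,2,1,3,2,3,2], [2,1,3,2,3,2,1,3,2,4,3,2,1,3,2,4,3,2,3],
   [1,3,2,3,2,4,3,2,3,2,4,3,2,1,3], [2,3,2,3,2,1,3,4,3,2,3,2,3,2],
   [3,2,1,3,4,3,2,3,2,3,2,1,3,4,3,2,3], [1,3,2,1,3,2,4,3,2,3,2,1,4,3,2,1,3], [], [],
   [2,1,3,2,3,2,4,3,2,3,2,4,3,2,1,3,2], [], [], [3,2,1,3,2,1,3,4,3,2,1,3,2,3],
   [1,3,2,4,3,2,3,2,4,3,2,1,3,2,1], [], [], [3,4,3,2,1,3,2,3,2,4,3,2,3,2,3], []]"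

text \<open>No backward tables: \<open>coords\<close> and \<open>down\<close> are evaluated only for
  \<open>Ws\<close>, that is, for \<open>W1\<close> to \<open>W5\<close>.\<close>

lemmas W6_eval = fw_24[OF W6_def, unfolded basic_eval gens_eval]

definition W7 :: "nat list list" where
  "W7 = [
   [], [], [], [], [], [], [], [], [], [], [], [], [], [], [], [], [],
   [2,1,3,2,3,2,1,3,2,3,2,4,3], [], [], [3,2,4,3,2,1,3,2,3,2,1,3,2], [], [], []]"

lemmas W7_eval = fw_24[OF W7_def, unfolded basic_eval gens_eval]

definition W1' :: "nat list list" where
  "W1' = [
   [4,3,2,3,4,6,1], [6,1], [3,4,1,2,3,2,3,4,6], [4,6], [4,2,3,2,3,4,6], [4,1,2,3,2,3,4,6],
   [2,3,2,3,4,6,1], [1,2,3,2,3,4,6], [4,3,2,3,4,6], [3,4,6,1], [1,2,3,2,3,4,6,1], [6], [3,4,6],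
   [4,6,1], [], [2,3,4,6,1], [3,2,3,4,6], [2,3,2,3,4,6], [6,4,3,2,3,4,6,1], [2,3,4,6],
   [3,4,2,3,2,3,4,6], [1], [6,4,3,2,3,4,6], [3,2,3,4,6,1]]"

lemmas W1'_eval = fw_24[OF W1'_def, unfolded basic_eval gens_eval]

definition W2' :: "nat list list" where
  "W2' = [
   [6,3,4,3,2,3,1,2,3,4,2,3,2,3,4,6,1], [4,6,4,3,2,3,4,3,1,2,3,2,3,4,2,3,2,3,4,6],
   [6,4,3,2,3,4,3,2,1,2,3,2,3,4,6,1], [6,3,2,3,4,3,1,2,3,2,3,4,2,3,2,3,4,6,1],
   [6,4,3,1,2,3,4,2,1,2,3,2,3,4,6,1], [6,4,2,1,2,3,2,3,4,2,1,2,3,2,3,4,6,1],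
   [2,3,4,6,3,4,3,2,3,2,3,4,2,3,2,3,4,6,1], [4,6,4,3,2,3,4,2,1,2,3,2,3,4,6,1],
   [4,6,4,3,2,3,2,3,4,2,3,2,3,4,6,1], [6,4,3,2,3,4,1,2,3,2,3,4,2,3,2,3,4,6],
   [6,2,3,4,3,2,3,1,2,3,4,2,3,2,3,4,6,1], [4,6,3,2,3,4,3,2,3,2,3,4,2,3,2,3,4,6,1],
   [6,2,3,4,3,2,3,2,3,4,2,3,2,3,4,6,1], [6,3,1,2,3,4,3,2,3,2,3,4,2,3,2,3,4,6,1], [],
   [4,6,3,4,3,1,2,3,2,3,4,2,3,2,3,4,6,1], [6,4,3,1,2,3,2,3,4,2,3,2,3,4,6,1],
   [6,4,2,3,1,2,3,2,3,4,2,3,2,3,4,6,1], [6,3,4,2,3,2,3,4,2,1,2,3,2,3,4,6,1],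
   [6,3,4,3,2,3,2,3,4,2,3,2,3,4,6,1], [6,3,4,2,3,2,3,1,2,3,4,2,3,2,3,4,6,1], [],
   [6,4,1,2,3,2,3,4,2,1,2,3,2,3,4,6,1], [3,4,6,3,4,3,2,3,2,3,4,2,3,2,3,4,6,1]]"

lemmas W2'_eval = fw_24[OF W2'_def, unfolded basic_eval gens_eval]

section \<open>The extended Golay code\<close>

lemma pts_upt: "pts = [1..<25]"
  by (simp add: pts_def upt_rec)

lemma length_pts [simp]: "length pts = 24"
  by (simp add: pts_upt)

lemma set_pts [simp]: "set pts = {1..24}"
  by (auto simp: pts_upt)

lemma distinct_pts [simp]: "distinct pts"
  by (simp add: pts_upt)

lemma length_pcomp [simp]: "length (pcomp p q) = length q"
  by (simp add: pcomp_def)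

lemma act_pts [simp]: "act pts = id"
  by (auto simp: act_def entry_def pts_upt)

lemma act_pcomp: "length p = 24 \<Longrightarrow> length q = 24 \<Longrightarrow> act (pcomp p q) = act p \<circ> act q"
  by (auto simp: pcomp_def act_def entry_def fun_eq_iff)

abbreviation M :: "(nat \<Rightarrow> nat) set" where
  "M \<equiv> carrier M24"

lemma M_iff: "f \<in> M \<longleftrightarrow> f permutes {1..24} \<and> (`) f ` golay_code = golay_code"
  by (simp add: M24_def)

lemma M_mult [simp]: "f \<otimes>\<^bsub>M24\<^esub> g = f \<circ> g"
  by (simp add: M24_def sym_group_def)

lemma M_one [simp]: "\<one>\<^bsub>M24\<^esub> = id"
  by (simp add: M24_def sym_group_def)

lemma M_comp: "f \<in> M \<Longrightarrow> g \<in> M \<Longrightarrow> f \<circ> g \<in> M"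
  using monoid.m_closed[OF group.is_monoid[OF group_M24], of f g] by simp

lemma M_id: "id \<in> M"
  using monoid.one_closed[OF group.is_monoid[OF group_M24]] by simp

lemma M_inverse:
  assumes "f \<in> M"
  obtains g where "g \<in> M" "g \<circ> f = id" "f \<circ> g = id"
  using group.inv_closed[OF group_M24 assms] group.l_inv[OF group_M24 assms]
    group.r_inv[OF group_M24 assms] that by simp

lemma M_inj: "f \<in> M \<Longrightarrow> f x = f y \<longleftrightarrow> x = y"
  by (meson M_iff permutes_inj injD)

lemma M_in: "f \<in> M \<Longrightarrow> f x \<in> {1..24} \<longleftrightarrow> x \<in> {1..24}"
  by (metis M_iff permutes_in_image)

lemma M_out: "f \<in> M \<Longrightarrow> x \<notin> {1..24} \<Longrightarrow> f x = x"
  by (metis M_iff permutes_not_in)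

lemma M_code: "f \<in> M \<Longrightarrow> X \<in> golay_code \<Longrightarrow> f ` X \<in> golay_code"
  using M_iff by blast


section \<open>Codewords as bit vectors\<close>

abbreviation (input) "T \<equiv> True"
abbreviation (input) "F \<equiv> False"

definition golay_vecs :: "bool list list" where
  "golay_vecs = [
   [F,T,T,T,T,F,T,F,T,T,F,F,T,T,F,F,T,F,T,F,F,F,F,T],
   [F,F,T,T,T,T,F,T,F,T,T,F,F,T,T,F,F,T,F,T,F,F,F,T],
   [F,F,F,T,T,T,T,F,T,F,T,T,F,F,T,T,F,F,T,F,T,F,F,T],
   [F,F,F,F,T,T,T,T,F,T,F,T,T,F,F,T,T,F,F,T,F,T,F,T],
   [F,F,F,F,F,T,T,T,T,F,T,F,T,T,F,F,T,T,F,F,T,F,T,T],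
   [T,F,F,F,F,F,T,T,T,T,F,T,F,T,T,F,F,T,T,F,F,T,F,T],
   [F,T,F,F,F,F,F,T,T,T,T,F,T,F,T,T,F,F,T,T,F,F,T,T],
   [T,F,T,F,F,F,F,F,T,T,T,T,F,T,F,T,T,F,F,T,T,F,F,T],
   [F,T,F,T,F,F,F,F,F,T,T,T,T,F,T,F,T,T,F,F,T,T,F,T],
   [F,F,T,F,T,F,F,F,F,F,T,T,T,T,F,T,F,T,T,F,F,T,T,T],
   [T,F,F,T,F,T,F,F,F,F,F,T,T,T,T,F,T,F,T,T,F,F,T,T],
   [T,T,F,F,T,F,T,F,F,F,F,F,T,T,T,T,F,T,F,T,T,F,F,T],
   [F,T,T,F,F,T,F,T,F,F,F,F,F,T,T,T,T,F,T,F,T,T,F,T],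
   [F,F,T,T,F,F,T,F,T,F,F,F,F,F,T,T,T,T,F,T,F,T,T,T],
   [T,F,F,T,T,F,F,T,F,T,F,F,F,F,F,T,T,T,T,F,T,F,T,T],
   [T,T,F,F,T,T,F,F,T,F,T,F,F,F,F,F,T,T,T,T,F,T,F,T],
   [F,T,T,F,F,T,T,F,F,T,F,T,F,F,F,F,F,T,T,T,T,F,T,T],
   [T,F,T,T,F,F,T,T,F,F,T,F,T,F,F,F,F,F,T,T,T,T,F,T],
   [F,T,F,T,T,F,F,T,T,F,F,T,F,T,F,F,F,F,F,T,T,T,T,T],
   [T,F,T,F,T,T,F,F,T,T,F,F,T,F,T,F,F,F,F,F,T,T,T,T],
   [T,T,F,T,F,T,T,F,F,T,T,F,F,T,F,T,F,F,F,F,F,T,T,T],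
   [T,T,T,F,T,F,T,T,F,F,T,T,F,F,T,F,T,F,F,F,F,F,T,T],
   [T,T,T,T,F,T,F,T,T,F,F,T,T,F,F,T,F,T,F,F,F,F,F,T]]"

hide_const (open) T F

lemma entry_23:
  assumes "xs = [x1, x2, x3, x4, x5, x6, x7, x8, x9, x10, x11, x12, x13, x14, x15, x16, x17, x18,
    x19, x20, x21, x22, x23]"
  shows
    "entry xs 1 = x1"
    "entry xs 2 = x2"
    "entry xs 3 = x3"
    "entry xs 4 = x4"
    "entry xs 5 = x5"
    "entry xs 6 = x6"
    "entry xs 7 = x7"
    "entry xs 8 = x8"
    "entry xs 9 = x9"
    "entry xs 10 = x10"
    "entry xs 11 = x11"
    "entry xs 12 = x12"
    "entry xs 13 = x13"
    "entry xs 14 = x14"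
    "entry xs 15 = x15"
    "entry xs 16 = x16"
    "entry xs 17 = x17"
    "entry xs 18 = x18"
    "entry xs 19 = x19"
    "entry xs 20 = x20"
    "entry xs 21 = x21"
    "entry xs 22 = x22"
    "entry xs 23 = x23"
  using assms by (simp_all add: entry_def)

lemmas golay_vecs_eval = entry_23[OF golay_vecs_def]


fun vxor :: "bool list \<Rightarrow> bool list \<Rightarrow> bool list" where
  "vxor (a # v) (b # w) = (a = (\<not> b)) # vxor v w"
| "vxor _ _ = []"

definition supp :: "bool list \<Rightarrow> nat set" where
  "supp v = {x \<in> {1..24}. entry v x}"

lemma length_vxor [simp]: "length (vxor v w) = min (length v) (length w)"
  by (induction v w rule: vxor.induct) auto

lemma nth_vxor: "i < length v \<Longrightarrow> i < length w \<Longrightarrow> vxor v w ! i \<longleftrightarrow> v ! i \<noteq> w ! i"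
  by (induction v w arbitrary: i rule: vxor.induct) (auto simp: nth_Cons split: nat.split)

lemma supp_vxor:
  "length v = 24 \<Longrightarrow> length w = 24 \<Longrightarrow> supp (vxor v w) = sym_diff (supp v) (supp w)"
  by (auto simp: supp_def entry_def nth_vxor)

primrec vsum :: "nat list \<Rightarrow> bool list" where
  "vsum [] = map (\<lambda>_. False) pts"
| "vsum (i # J) = vxor (vsum J) (entry golay_vecs i)"

text \<open>The set lists the nonzero squares modulo 23; only the roots 0, ..., 22 have to be
  tried.\<close>

lemma Legendre_23: "Legendre a 23 = 1 \<longleftrightarrow> a mod 23 \<in> {1,2,3,4,6,8,9,12,13,16,18}"
proof -
  have "QuadRes 23 a \<longleftrightarrow> (\<exists>y. y\<^sup>2 mod 23 = a mod 23)"
    by (simp add: QuadRes_def cong_def)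
  also have "\<dots> \<longleftrightarrow> (\<exists>y\<in>{0..<23}. y\<^sup>2 mod 23 = a mod 23)"
  proof
    assume "\<exists>y. y\<^sup>2 mod 23 = a mod 23"
    then obtain y where "y\<^sup>2 mod 23 = a mod 23" by blast
    then have "(y mod 23)\<^sup>2 mod 23 = a mod 23" "y mod 23 \<in> {0..<23}"
      by (simp_all add: power_mod)
    then show "\<exists>y\<in>{0..<23}. y\<^sup>2 mod 23 = a mod 23" by blast
  qed blast
  also have "{0..<23::int} = set [0..22]"
    by auto
  also have "\<dots> = {0,1,2,3,4,5,6,7,8,9,10,11,12,13,14,15,16,17,18,19,20,21,22}"
    by (simp add: upto.simps)
  finally show ?thesis
    by (auto simp: Legendre_def cong_def)
qed

text \<open>Adding 23 before subtracting \<open>i\<close> keeps the difference of natural numbers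
  from being cut off at 0.\<close>

lemma golay_word_mem:
  assumes "i \<in> {1..23}" "x \<in> {1..24}"
  shows "x \<in> golay_word i \<longleftrightarrow> x = 24 \<or> (x + 23 - i) mod 23 \<in> {1,2,3,4,6,8,9,12,13,16,18}"
proof -
  have "int ((x + 23 - i) mod 23) = (int x - int i + 23) mod 23"
    unfolding zmod_int using assms by (intro arg_cong2[where f = "(mod)"]) auto
  also have "\<dots> = (int x - int i) mod 23"
    by simp
  finally have "(int x - int i) mod 23 = int ((x + 23 - i) mod 23)" ..
  then show ?thesis
    using assms by (auto simp: golay_word_def Legendre_23)
qed

lemma golay_vecs_check:
  "list_all (\<lambda>i. list_all (\<lambda>x. entry (entry golay_vecs i) x \<longleftrightarrow>
      x = 24 \<or> elem ((x + 23 - i) mod 23) [1,2,3,4,6,8,9,12,13,16,18]) pts)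
    [1,2,3,4,5,6,7,8,9,10,11,12,13,14,15,16,17,18,19,20,21,22,23]"
  apply (simp only: pts_def list.pred_inject golay_vecs_eval entry_24 simp_thms)
  apply simp
  done

lemma golay_indices: "[1,2,3,4,5,6,7,8,9,10,11,12,13,14,15,16,17,18,19,20,21,22,23] = [1..<24]"
  by (simp add: upt_rec)

lemma golay_vecs_nth:
  assumes "i \<in> {1..23}"
  shows "length (entry golay_vecs i) = 24" and "supp (entry golay_vecs i) = golay_word i"
proof -
  have "list_all (\<lambda>v. length v = 24) golay_vecs" and len: "length golay_vecs = 23"
    by (simp_all add: golay_vecs_def)
  then show "length (entry golay_vecs i) = 24"
    using assms by (auto simp: list_all_length entry_def)
  have "x \<in> supp (entry golay_vecs i) \<longleftrightarrow> x \<in> golay_word i" if "x \<in> {1..24}" for x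
  proof -
    have "\<forall>i\<in>set [1..<24]. \<forall>x\<in>set pts. entry (entry golay_vecs i) x \<longleftrightarrow>
        x = 24 \<or> (x + 23 - i) mod 23 \<in> set [1,2,3,4,6,8,9,12,13,16,18]"
      using golay_vecs_check unfolding golay_indices list_all_iff elem_iff .
    moreover have "i \<in> set [1..<24]" "x \<in> set pts"
      using assms that by auto
    ultimately have "entry (entry golay_vecs i) x \<longleftrightarrow>
        x = 24 \<or> (x + 23 - i) mod 23 \<in> set [1,2,3,4,6,8,9,12,13,16,18]"
      by blast
    also have "\<dots> \<longleftrightarrow> x \<in> golay_word i"
      unfolding golay_word_mem[OF assms that] by (simp only: list.set)
    finally show ?thesis
      using that by (simp add: supp_def)
  qed
  moreover have "golay_word i \<subseteq> {1..24}" "supp (entry golay_vecs i) \<subseteq> {1..24}"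
    by (auto simp: golay_word_def supp_def)
  ultimately show "supp (entry golay_vecs i) = golay_word i"
    by blast
qed

text \<open>Gaussian elimination; the number in each pair is the pivot. Soundness holds for any list
  of codewords, and the choice of pivots decides only whether the test succeeds.\<close>

primrec spanned :: "(nat \<times> bool list) list \<Rightarrow> bool list \<Rightarrow> bool" where
  "spanned [] v = list_all Not v"
| "spanned (ke # es) v = spanned es (if entry v (fst ke) then vxor v (snd ke) else v)"

lemma vsum_code:
  assumes "set J \<subseteq> {1..23}"
  shows "length (vsum J) = 24 \<and> supp (vsum J) \<in> golay_code"
  using assms
proof (induction J)
  case Nil
  have "supp (vsum []) = {}"
    by (auto simp: supp_def entry_def pts_upt)
  then show ?case
    by (simp add: golay_code.zero)
next
  case (Cons i J)
  then have "i \<in> {1..23}" and IH: "length (vsum J) = 24" "supp (vsum J) \<in> golay_code"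
    by auto
  then show ?case
    using golay_vecs_nth[OF \<open>i \<in> {1..23}\<close>] golay_code.add[OF IH(2) \<open>i \<in> {1..23}\<close>]
    by (simp add: supp_vxor)
qed

lemma code_sym_diff:
  assumes "X \<in> golay_code" "Y \<in> golay_code"
  shows "sym_diff X Y \<in> golay_code"
  using assms(2)
proof (induction rule: golay_code.induct)
  case zero
  then show ?case using assms(1) by simp
next
  case (add Y i)
  have "sym_diff X (sym_diff Y (golay_word i)) = sym_diff (sym_diff X Y) (golay_word i)"
    by blast
  then show ?case using golay_code.add[OF add.IH add.hyps(2)] by simp
qed

lemma code_subset: "X \<in> golay_code \<Longrightarrow> X \<subseteq> {1..24}"
  by (induction rule: golay_code.induct) (auto simp: golay_word_def)

lemma supp_all_False: "length v = 24 \<Longrightarrow> list_all Not v \<Longrightarrow> supp v = {}"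
  by (auto simp: supp_def entry_def list_all_length)

lemma spanned_code:
  assumes "\<And>k e. (k, e) \<in> set es \<Longrightarrow> length e = 24 \<and> supp e \<in> golay_code"
    and "length v = 24" "spanned es v"
  shows "supp v \<in> golay_code"
  using assms
proof (induction es arbitrary: v)
  case Nil
  then show ?case
    by (simp add: supp_all_False golay_code.zero)
next
  case (Cons ke es)
  obtain k e where ke: "ke = (k, e)" by (cases ke)
  have e: "length e = 24" "supp e \<in> golay_code"
    using Cons.prems(1) ke by auto
  show ?case
  proof (cases "entry v k")
    case True
    then have "supp (vxor v e) \<in> golay_code"
      using Cons.prems ke e by (intro Cons.IH) auto
    then have "sym_diff (supp (vxor v e)) (supp e) \<in> golay_code"
      using e by (intro code_sym_diff)
    moreover have "sym_diff (supp (vxor v e)) (supp e) = supp v"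
      using Cons.prems(2) e by (auto simp: supp_vxor)
    ultimately show ?thesis by simp
  next
    case False
    then show ?thesis
      using Cons.prems ke by (intro Cons.IH) auto
  qed
qed

text \<open>Row \<open>k\<close> names the generating words whose sum has its pivot at the point
  \<open>k\<close>. There are twelve pivots because the code has dimension 12.\<close>

definition echelon :: "nat list list" where
  "echelon = [
   [2,3,7,10,12], [1,2,5], [6,7,10,12], [1,2,3,4,5,7], [2,3,4,5,6,8], [2,4,5,6,9,10,12],
   [1,2,4,6,7,8,10], [2,3,5,7,8,9,11], [2,4,6,7,8,9], [2,5,8,9,12], [1,3,4,5,6,7,8,9,11,12],
   [1,2,6,9,11]]"
definition golay_basis :: "(nat \<times> bool list) list" where
  "golay_basis = zip [1,2,3,4,5,6,7,8,9,10,11,12] (map vsum echelon)"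

lemma golay_basis_code: "(k, e) \<in> set golay_basis \<Longrightarrow> length e = 24 \<and> supp e \<in> golay_code"
proof -
  assume "(k, e) \<in> set golay_basis"
  then have "e \<in> set (map vsum echelon)"
    unfolding golay_basis_def by (rule set_zip_rightD)
  then obtain J where J: "J \<in> set echelon" "e = vsum J"
    by auto
  moreover have "list_all (list_all (\<lambda>i. i \<in> {1..23})) echelon"
    by (simp add: echelon_def)
  ultimately have "set J \<subseteq> {1..23}"
    by (auto simp: list_all_iff)
  then show "length e = 24 \<and> supp e \<in> golay_code"
    using J vsum_code by simp
qed

lemma vxor_24:
  "vxor [a1, a2, a3, a4, a5, a6, a7, a8, a9, a10, a11, a12, a13, a14, a15, a16, a17, a18, a19, a20,
    a21, a22, a23, a24]
    [b1, b2, b3, b4, b5, b6, b7, b8, b9, b10, b11, b12, b13, b14, b15, b16, b17, b18, b19, b20, b21,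
      b22, b23, b24] =
   [a1 = (\<not> b1), a2 = (\<not> b2), a3 = (\<not> b3), a4 = (\<not> b4), a5 = (\<not> b5), a6 = (\<not> b6), a7 = (\<not> b7), a8 =
     (\<not> b8), a9 = (\<not> b9), a10 = (\<not> b10), a11 = (\<not> b11), a12 = (\<not> b12), a13 = (\<not> b13), a14 = (\<not> b14),
     a15 = (\<not> b15), a16 = (\<not> b16), a17 = (\<not> b17), a18 = (\<not> b18), a19 = (\<not> b19), a20 = (\<not> b20), a21 =
     (\<not> b21), a22 = (\<not> b22), a23 = (\<not> b23), a24 = (\<not> b24)]"
  by (simp only: vxor.simps)

lemmas vec_eval = vxor_24 vsum.simps golay_vecs_eval

lemmas golay_basis_eval = golay_basis_def[unfolded echelon_def basic_eval vec_eval zip.simps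
  list.case]

section \<open>Five-fold transitivity\<close>

lemma gens_check:
  "list_all (\<lambda>p. pcomp p p = pts \<and>
      list_all (\<lambda>v. spanned golay_basis (map (entry v) p)) golay_vecs) gens"
  by (simp only: gens_def golay_vecs_def golay_basis_eval spanned.simps
      basic_eval vxor_24 cong: weak_congs)

lemma gens_length: "p \<in> set gens \<Longrightarrow> length p = 24"
  by (auto simp: gens_def)

lemma entry_in: "i \<in> {1..length xs} \<Longrightarrow> entry xs i \<in> set xs"
  by (auto simp: entry_def)

lemma gens_in: "i \<in> {1..6} \<Longrightarrow> entry gens i \<in> set gens"
  by (rule entry_in) (simp add: gens_def)

lemma image_sym_diff: "inj f \<Longrightarrow> f ` sym_diff X Y = sym_diff (f ` X) (f ` Y)"
  by (simp add: image_Un image_set_diff)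

lemma involution_M:
  assumes len: "length p = 24" and sq: "pcomp p p = pts"
    and code: "\<And>v. v \<in> set golay_vecs \<Longrightarrow> spanned golay_basis (map (entry v) p)"
  shows "act p \<in> M"
proof -
  let ?f = "act p"
  have id: "?f \<circ> ?f = id"
    using act_pcomp[OF len len] by (simp add: sq)
  then have inv: "?f (?f x) = x" for x
    by (metis comp_apply id_apply)
  have perm: "?f permutes {1..24}"
    unfolding permutes_def
  proof (intro conjI allI impI)
    show "?f x = x" if "x \<notin> {1..24}" for x
      using that len unfolding act_def by presburger
    show "\<exists>!x. ?f x = y" for y
      by (metis inv)
  qed
  have im: "x \<in> ?f ` S \<longleftrightarrow> ?f x \<in> S" for x S
    by (metis imageI image_iff inv)
  have inj: "inj ?f"
    using perm by (rule permutes_inj)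
  have word: "?f ` golay_word i \<in> golay_code" if i: "i \<in> {1..23}" for i
  proof -
    let ?v = "entry golay_vecs i"
    \<comment> \<open>Reading the entries of \<open>?v\<close> along \<open>p\<close> pulls its
      support back; for an involution the preimage is the image.\<close>
    have "x \<in> supp (map (entry ?v) p) \<longleftrightarrow> ?f x \<in> supp ?v" for x
      using permutes_in_image[OF perm, of x] len by (auto simp: supp_def entry_def act_def)
    then have "supp (map (entry ?v) p) = ?f ` supp ?v"
      using im by blast
    moreover have "?v \<in> set golay_vecs"
      using i by (intro entry_in) (simp add: golay_vecs_def)
    ultimately show ?thesis
      using spanned_code[OF golay_basis_code _ code] len golay_vecs_nth[OF i] by force
  qed
  have sub: "?f ` X \<in> golay_code" if "X \<in> golay_code" for X
    using that
  proof (induction rule: golay_code.induct)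
    case zero
    then show ?case by (simp add: golay_code.zero)
  next
    case (add X i)
    then show ?case
      using code_sym_diff[OF add.IH word[OF add.hyps(2)]] by (simp add: image_sym_diff[OF inj])
  qed
  \<comment> \<open>Mapping the code into itself is enough, because \<open>?f\<close> is its own
    inverse.\<close>
  have "?f ` ?f ` X = X" for X
    by (simp add: image_comp id)
  then have "(`) ?f ` golay_code = golay_code"
    using sub by (metis (no_types, lifting) image_eqI image_subsetI subset_antisym subsetI)
  then show ?thesis
    using perm by (simp add: M_iff)
qed

abbreviation gf :: "nat \<Rightarrow> nat \<Rightarrow> nat" where
  "gf i \<equiv> act (entry gens i)"

lemma gf_M: "i \<in> {1..6} \<Longrightarrow> gf i \<in> M"
  using gens_check gens_length gens_in by (intro involution_M) (auto simp: list_all_iff)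

lemma gf_gf: "i \<in> {1..6} \<Longrightarrow> gf i \<circ> gf i = id"
  using gens_check gens_length[OF gens_in, of i] gens_in[of i]
  by (auto simp: list_all_iff simp flip: act_pcomp)

section \<open>Words, stabiliser chains and sifting\<close>

lemma wfun_append: "wfun s (v @ w) = wfun s v \<circ> wfun s w"
  by (induction v) (auto simp: o_assoc)

lemma wtab_gens:
  assumes "set w \<subseteq> {1..6}"
  shows "length (wtab gens w) = 24" "act (wtab gens w) = wfun gf w" "wfun gf w \<in> M"
proof -
  have "length (wtab gens w) = 24 \<and> act (wtab gens w) = wfun gf w \<and> wfun gf w \<in> M"
    using assms
    by (induction w) (auto simp: M_id act_pcomp gens_length[OF gens_in] intro!: M_comp gf_M)
  then show "length (wtab gens w) = 24" "act (wtab gens w) = wfun gf w" "wfun gf w \<in> M"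
    by auto
qed

lemma wfun_rev:
  assumes "\<And>i. i \<in> set w \<Longrightarrow> s i \<circ> s i = id"
  shows "wfun s (rev w) \<circ> wfun s w = id"
  using assms
proof (induction w)
  case (Cons i w)
  have "wfun s (rev (i # w)) \<circ> wfun s (i # w) = wfun s (rev w) \<circ> (s i \<circ> s i) \<circ> wfun s w"
    by (simp add: wfun_append o_assoc)
  also have "s i \<circ> s i = id"
    by (rule Cons.prems) simp
  also have "wfun s (rev w) \<circ> id \<circ> wfun s w = id"
    unfolding comp_id by (rule Cons.IH) (rule Cons.prems, simp)
  finally show ?case .
qed simp

definition level :: "nat list \<Rightarrow> nat \<Rightarrow> nat list list \<Rightarrow> nat \<Rightarrow> nat list \<Rightarrow> nat list \<Rightarrow> bool" where
  "level L n W b fs ys \<longleftrightarrow>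
     length W = 24 \<and> list_all (\<lambda>w. length w \<le> n \<and> list_all (\<lambda>i. elem i L) w) W \<and>
     list_all (\<lambda>y. act (fw W y) b = y \<and> list_all (\<lambda>z. act (fw W y) z = z) fs) ys"

lemma levelD:
  assumes "level L n W b fs ys" "set L \<subseteq> {1..6}" "y \<in> set ys" "y \<in> {1..24}"
  shows "length (fw W y) = 24" "length (bk W y) = 24" "act (fw W y) = wfun gf (entry W y)"
    "set (entry W y) \<subseteq> set L" "length (entry W y) \<le> n"
    "act (fw W y) \<in> M" "act (bk W y) \<in> M"
    "act (bk W y) \<circ> act (fw W y) = id" "act (fw W y) \<circ> act (bk W y) = id"
    "act (fw W y) b = y" "\<And>z. z \<in> set fs \<Longrightarrow> act (fw W y) z = z"
    "act (bk W y) y = b" "\<And>z. z \<in> set fs \<Longrightarrow> act (bk W y) z = z"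
proof -
  have w: "entry W y \<in> set W"
    using assms by (auto simp: level_def entry_def)
  then show L: "set (entry W y) \<subseteq> set L" and "length (entry W y) \<le> n"
    using assms by (auto simp: level_def list_all_iff)
  then have w6: "set (entry W y) \<subseteq> {1..6}" "set (rev (entry W y)) \<subseteq> {1..6}"
    using assms(2) by auto
  show len: "length (fw W y) = 24" "length (bk W y) = 24"
    and f: "act (fw W y) = wfun gf (entry W y)"
    and "act (fw W y) \<in> M" and g: "act (bk W y) \<in> M"
    using wtab_gens[OF w6(1)] wtab_gens[OF w6(2)] by (auto simp: fw_def bk_def)
  have b: "act (bk W y) = wfun gf (rev (entry W y))"
    using wtab_gens[OF w6(2)] by (simp add: bk_def)
  have sq: "gf i \<circ> gf i = id" if "i \<in> set (entry W y)" for i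
    using w6 that gf_gf by blast
  show bf: "act (bk W y) \<circ> act (fw W y) = id"
    unfolding f b by (rule wfun_rev) (rule sq)
  show "act (fw W y) \<circ> act (bk W y) = id"
    unfolding f b using wfun_rev[of "rev (entry W y)" gf] sq by simp
  show fz: "act (fw W y) z = z" if "z \<in> set fs" for z
    using assms that by (auto simp: level_def list_all_iff)
  show fb: "act (fw W y) b = y"
    using assms by (auto simp: level_def list_all_iff)
  show "act (bk W y) y = b"
    using fun_cong[OF bf, of b] fb by simp
  show "act (bk W y) z = z" if "z \<in> set fs" for z
    using fun_cong[OF bf, of z] fz[OF that] by simp
qed

text \<open>Every level has to reach all points that are not earlier base points, so five valid
  levels witness 5-transitivity. The sixth and seventh orbits are smaller and are treated separately
  in \<open>stab_levels\<close>.\<close>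

fun valid :: "nat list \<Rightarrow> nat list list list \<Rightarrow> nat list \<Rightarrow> nat list \<Rightarrow> nat list \<Rightarrow> bool" where
  "valid L [] [] [] fs = True"
| "valid L (W # Ws) (n # ns) (b # bs) fs =
     (level L n W b fs (filter (\<lambda>y. \<not> elem y fs) pts) \<and> valid L Ws ns bs (b # fs))"
| "valid _ _ _ _ _ = False"

text \<open>Sifting of a tuple: \<open>coords\<close> records which representative is divided out at
  each level, \<open>down\<close> composes the inverse representatives, and \<open>up\<close>
  composes the representatives themselves.\<close>

fun coords :: "nat list list list \<Rightarrow> nat list \<Rightarrow> nat list" where
  "coords (W # Ws) (x # xs) = x # coords Ws (map (act (bk W x)) xs)"
| "coords _ _ = []"

fun down :: "nat list list list \<Rightarrow> nat list \<Rightarrow> nat \<Rightarrow> nat" where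
  "down (W # Ws) (c # cs) x = down Ws cs (act (bk W c) x)"
| "down _ _ x = x"

fun up :: "nat list list list \<Rightarrow> nat list \<Rightarrow> nat list \<Rightarrow> nat list" where
  "up (W # Ws) (c # cs) p = pcomp (fw W c) (up Ws cs p)"
| "up _ _ p = p"

text \<open>Once the first representative is divided out, the remaining entries avoid the base point
  just reached, so the induction applies to them. The word \<open>w\<close> concatenates the chosen
  representatives, which is why the bounds \<open>ns\<close> add up.\<close>

lemma chain:
  assumes "valid L Ws ns bs fs" "length xs = length Ws" "distinct xs" "set xs \<subseteq> {1..24} - set fs"
    and L: "set L \<subseteq> {1..6}"
  defines "cs \<equiv> coords Ws xs"
  obtains w where "set w \<subseteq> set L" "length w \<le> sum_list ns"
    "wfun gf w \<circ> down Ws cs = id" "down Ws cs \<circ> wfun gf w = id" "down Ws cs \<in> M"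
    "map (down Ws cs) xs = bs" "\<And>z. z \<in> set fs \<Longrightarrow> down Ws cs z = z"
    "\<And>p. length p = 24 \<Longrightarrow> length (up Ws cs p) = 24"
    "\<And>p. length p = 24 \<Longrightarrow> act (up Ws cs p) = wfun gf w \<circ> act p"
proof -
  have "\<exists>w. set w \<subseteq> set L \<and> length w \<le> sum_list ns \<and>
    wfun gf w \<circ> down Ws cs = id \<and> down Ws cs \<circ> wfun gf w = id \<and> down Ws cs \<in> M \<and>
    map (down Ws cs) xs = bs \<and> (\<forall>z\<in>set fs. down Ws cs z = z) \<and>
    (\<forall>p. length p = 24 \<longrightarrow> length (up Ws cs p) = 24 \<and> act (up Ws cs p) = wfun gf w \<circ> act p)"
    using assms(1-4) unfolding cs_def
  proof (induction Ws arbitrary: ns bs fs xs)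
    case Nil
    have "down [] [] = id" by auto
    then show ?case using Nil by (cases ns; cases bs) (auto simp: M_id[unfolded id_def])
  next
    case (Cons W Ws)
    obtain x xs' where xs: "xs = x # xs'"
      using Cons.prems(2) by (cases xs) auto
    obtain n ns' where ns: "ns = n # ns'"
      using Cons.prems(1) by (cases ns) auto
    obtain b bs' where bs: "bs = b # bs'"
      using Cons.prems(1) by (cases bs) (auto simp: ns)
    have lev: "level L n W b fs (filter (\<lambda>y. \<not> elem y fs) pts)" and val: "valid L Ws ns' bs' (b # fs)"
      using Cons.prems(1) by (auto simp: ns bs)
    have x: "x \<in> set (filter (\<lambda>y. \<not> elem y fs) pts)" "x \<in> {1..24}"
      using Cons.prems(4) xs by auto
    note l = levelD[OF lev L x]
    let ?h = "act (bk W x)" and ?k = "act (fw W x)"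
    have h: "?h u = ?h v \<longleftrightarrow> u = v" for u v
      by (rule M_inj[OF l(7)])
    have "?h y \<in> {1..24} - set (b # fs)" if "y \<in> set xs'" for y
    proof -
      have y: "y \<noteq> x" "y \<in> {1..24}" "y \<notin> set fs"
        using that Cons.prems(3,4) xs by auto
      then have "?h y \<noteq> b" using l(12) h by metis
      moreover have "?h y \<notin> set fs" using l(13)[of "?h y"] y h by metis
      ultimately show ?thesis using M_in[OF l(7)] y by simp
    qed
    then have sub: "set (map ?h xs') \<subseteq> {1..24} - set (b # fs)"
      by auto
    have dist: "distinct (map ?h xs')" "length (map ?h xs') = length Ws"
      using Cons.prems(2,3) by (auto simp: xs distinct_map inj_on_def h)
    obtain d cs where cs: "cs = coords Ws (map ?h xs')" "d = down Ws cs" by blast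
    obtain w where w: "set w \<subseteq> set L" "length w \<le> sum_list ns'"
      "wfun gf w \<circ> d = id" "d \<circ> wfun gf w = id" "d \<in> M"
      "map d (map ?h xs') = bs'" "\<forall>z\<in>set (b # fs). d z = z"
      "\<forall>p. length p = 24 \<longrightarrow> length (up Ws cs p) = 24 \<and> act (up Ws cs p) = wfun gf w \<circ> act p"
      using Cons.IH[OF val dist(2,1) sub] unfolding cs by blast
    have D: "down (W # Ws) (coords (W # Ws) xs) = d \<circ> ?h"
      by (auto simp: xs cs)
    let ?w = "entry W x @ w"
    have F: "wfun gf ?w = ?k \<circ> wfun gf w"
      by (simp add: wfun_append l(3))
    have "wfun gf ?w \<circ> (d \<circ> ?h) = ?k \<circ> (wfun gf w \<circ> d) \<circ> ?h"
      unfolding F by (simp only: o_assoc)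
    then have 1: "wfun gf ?w \<circ> (d \<circ> ?h) = id"
      using w(3) l(9) by simp
    have "(d \<circ> ?h) \<circ> wfun gf ?w = d \<circ> (?h \<circ> ?k) \<circ> wfun gf w"
      unfolding F by (simp only: o_assoc)
    then have 2: "(d \<circ> ?h) \<circ> wfun gf ?w = id"
      using w(4) l(8) by simp
    have U: "length (up (W # Ws) (coords (W # Ws) xs) p) = 24 \<and>
        act (up (W # Ws) (coords (W # Ws) xs) p) = wfun gf ?w \<circ> act p" if "length p = 24" for p
      using w(8) that l(1) unfolding F by (simp add: xs cs(1)[symmetric] act_pcomp o_assoc)
    show ?case
      unfolding D
    proof (intro exI[of _ ?w] conjI)
      show "set ?w \<subseteq> set L" "length ?w \<le> sum_list ns"
        using l(4,5) w(1,2) ns by auto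
      show "d \<circ> ?h \<in> M" by (intro M_comp w l)
      show "map (d \<circ> ?h) xs = bs"
        using w(6,7) l(12) by (auto simp: xs bs)
      show "\<forall>z\<in>set fs. (d \<circ> ?h) z = z"
        using w(7) l(13) by simp
    qed (rule 1, rule 2, use U in blast)
  qed
  then show thesis using that by blast
qed

definition base :: "nat list" where "base = [15, 22, 17, 24, 14]"
definition Ws :: "nat list list list" where "Ws = [W1, W2, W3, W4, W5]"
definition Ws' :: "nat list list list" where "Ws' = [W1', W2', W3, W4, W5]"

lemmas W_evals = W1_eval W2_eval W3_eval W4_eval W5_eval W6_eval W7_eval W1'_eval W2'_eval

lemma Ws_lengths:
  "length W1 = 24 \<and> list_all (\<lambda>w. length w \<le> 7 \<and> list_all (\<lambda>i. elem i [1,2,3,4,5]) w) W1"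
  "length W2 = 24 \<and> list_all (\<lambda>w. length w \<le> 18 \<and> list_all (\<lambda>i. elem i [1,2,3,4,5]) w) W2"
  "length W1' = 24 \<and> list_all (\<lambda>w. length w \<le> 9 \<and> list_all (\<lambda>i. elem i [1,2,3,4,6]) w) W1'"
  "length W2' = 24 \<and> list_all (\<lambda>w. length w \<le> 20 \<and> list_all (\<lambda>i. elem i [1,2,3,4,6]) w) W2'"
  "length W3 = 24 \<and> list_all (\<lambda>w. length w \<le> 5 \<and> list_all (\<lambda>i. elem i [1,2,3,4]) w) W3"
  "length W4 = 24 \<and> list_all (\<lambda>w. length w \<le> 13 \<and> list_all (\<lambda>i. elem i [1,2,3,4]) w) W4"
  "length W5 = 24 \<and> list_all (\<lambda>w. length w \<le> 15 \<and> list_all (\<lambda>i. elem i [1,2,3,4]) w) W5"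
  "length W6 = 24 \<and> list_all (\<lambda>w. length w \<le> 21 \<and> list_all (\<lambda>i. elem i [1,2,3,4]) w) W6"
  "length W7 = 24 \<and> list_all (\<lambda>w. length w \<le> 13 \<and> list_all (\<lambda>i. elem i [1,2,3,4]) w) W7"
  by (simp_all add: W1_def W2_def W1'_def W2'_def W3_def W4_def W5_def W6_def W7_def)

lemma level_mono:
  assumes "length W = 24 \<and> list_all (\<lambda>w. length w \<le> n \<and> list_all (\<lambda>i. elem i L) w) W" "set L \<subseteq> set L'"
    "list_all (\<lambda>y. act (fw W y) b = y \<and> list_all (\<lambda>z. act (fw W y) z = z) fs) ys"
  shows "level L' n W b fs ys"
  using assms by (auto simp: level_def list_all_iff)

lemma valid_Ws: "valid [1,2,3,4,5] Ws [7,18,5,13,15] base []"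
  unfolding Ws_def base_def valid.simps
  by (intro conjI TrueI Ws_lengths[THEN level_mono];
      simp only: basic_eval W_evals list.set subset_refl cong: weak_congs; simp)

lemma valid_Ws': "valid [1,2,3,4,6] Ws' [9,20,5,13,15] base []"
  unfolding Ws'_def base_def valid.simps
  by (intro conjI TrueI Ws_lengths[THEN level_mono];
      simp only: basic_eval W_evals list.set subset_refl cong: weak_congs; simp)

section \<open>Octads and the stabiliser of five points\<close>

primrec odd_meet :: "bool list \<Rightarrow> nat list \<Rightarrow> bool" where
  "odd_meet v [] = False"
| "odd_meet v (x # xs) = (if entry v x then \<not> odd_meet v xs else odd_meet v xs)"

lemma odd_meet:
  assumes "distinct xs" "set xs \<subseteq> {1..24}"
  shows "odd_meet v xs \<longleftrightarrow> odd (card (set xs \<inter> supp v))"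
  using assms by (induction xs) (auto simp: supp_def Int_insert_left)

lemma set_filter_entry: "set (filter (entry v) pts) = supp v"
  by (auto simp: supp_def)

lemma golay_vecs_orthogonal:
  "list_all (\<lambda>q. list_all (\<lambda>v. \<not> odd_meet v q) golay_vecs) (map (\<lambda>w. filter (entry w) pts)
    golay_vecs)"
  by (simp only: golay_vecs_def odd_meet.simps basic_eval cong: weak_congs)

lemma golay_vec_in: "i \<in> {1..23} \<Longrightarrow> entry golay_vecs i \<in> set golay_vecs"
  by (rule entry_in) (simp add: golay_vecs_def)

lemma even_card_sym_diff:
  assumes "finite A" "finite B"
  shows "even (card (sym_diff A B)) \<longleftrightarrow> (even (card A) \<longleftrightarrow> even (card B))"
proof -
  have "card (sym_diff A B) = card (A - B) + card (B - A)"
    using assms by (intro card_Un_disjoint) auto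
  moreover have "card A = card (A - B) + card (A \<inter> B)" "card B = card (B - A) + card (A \<inter> B)"
    using assms by (subst card_Un_disjoint[symmetric]; auto intro!: arg_cong[where f = card])+
  ultimately show ?thesis
    by presburger
qed

text \<open>Even intersection is preserved by symmetric differences, so
  \<open>golay_vecs_orthogonal\<close> extends to the whole code. It serves to show that certain
  small sets are not codewords.\<close>

lemma code_orthogonal:
  assumes "X \<in> golay_code" "v \<in> set golay_vecs"
  shows "even (card (X \<inter> supp v))"
  using assms(1)
proof (induction rule: golay_code.induct)
  case zero
  then show ?case by simp
next
  case (add X i)
  have "\<not> odd_meet v (filter (entry (entry golay_vecs i)) pts)"
    using golay_vecs_orthogonal golay_vec_in[OF add.hyps(2)] assms(2) by (auto simp: list_all_iff)
  then have "even (card (golay_word i \<inter> supp v))"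
    using odd_meet[of "filter (entry (entry golay_vecs i)) pts" v] golay_vecs_nth(2)[OF add.hyps(2)]
      code_subset[OF golay_code.add[OF golay_code.zero add.hyps(2)]]
    unfolding set_filter_entry by simp
  moreover have "sym_diff X (golay_word i) \<inter> supp v = sym_diff (X \<inter> supp v) (golay_word i \<inter> supp v)"
    by blast
  moreover have "finite (Y \<inter> supp v)" for Y
    by (simp add: supp_def)
  ultimately show ?case
    using add.IH by (simp add: even_card_sym_diff)
qed

lemma to_base:
  assumes "length xs = 5" "distinct xs" "set xs \<subseteq> {1..24}"
  obtains d where "d \<in> M" "map d xs = base"
proof -
  have "set xs \<subseteq> {1..24} - set []" "length xs = length Ws" "set [1,2,3,4,5] \<subseteq> {1..6::nat}"
    using assms by (auto simp: Ws_def)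
  from chain[OF valid_Ws this(2) assms(2) this(1,3)] that show ?thesis
    by metis
qed

text \<open>By 5-transitivity a nonempty word of weight at most 6 could be moved to one of these sets,
  none of which is orthogonal to the code.\<close>

lemma small_check:
  "list_all (\<lambda>xs. list_ex (\<lambda>v. odd_meet v xs) golay_vecs)
     ([[15], [15,22], [15,22,17], [15,22,17,24], [15,22,17,24,14]] @
      map (\<lambda>y. [y,15,22,17,24,14]) (filter (\<lambda>y. \<not> elem y base) pts))"
  by (simp only: golay_vecs_def base_def odd_meet.simps basic_eval cong: weak_congs)

lemma base_props: "distinct base" "set base \<subseteq> {1..24}" "length base = 5"
  by (simp_all add: base_def)

lemma not_code:
  assumes "list_ex (\<lambda>v. odd_meet v xs) golay_vecs" "distinct xs" "set xs \<subseteq> {1..24}"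
  shows "set xs \<notin> golay_code"
  using assms code_orthogonal[of "set xs"] odd_meet[OF assms(2,3)] by (auto simp: list_ex_iff)

text \<open>The bound 6 is what \<open>octad_unique\<close> needs, as two distinct octads with five
  common points would differ in at most 3 + 3 points. Sets with fewer than five points are padded to
  five before they are moved to the base.\<close>

lemma min_weight:
  assumes X: "X \<in> golay_code" "X \<noteq> {}"
  shows "card X > 6"
proof (rule ccontr)
  assume "\<not> card X > 6"
  have fin: "finite X" "X \<subseteq> {1..24}"
    using code_subset[OF X(1)] finite_subset by auto
  show False
  proof (cases "card X \<le> 5")
    case True
    define k where "k = card X"
    have k: "k \<in> {1,2,3,4,5}"
      using True card_gt_0_iff[of X] X(2) fin unfolding k_def by auto
    have "card ({1..24} - X) \<ge> 5 - k"
      using fin True by (simp add: card_Diff_subset k_def)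
    then obtain Z where Z: "Z \<subseteq> {1..24} - X" "card Z = 5 - k" "finite Z"
      by (rule obtain_subset_with_card_n)
    obtain xs zs where xs: "set xs = X" "distinct xs" and zs: "set zs = Z" "distinct zs"
      using fin Z(3) finite_distinct_list by metis
    have len: "length xs = k" "length zs = 5 - k"
      using distinct_card[OF xs(2)] distinct_card[OF zs(2)] xs zs Z by (auto simp: k_def)
    have "length (xs @ zs) = 5" "distinct (xs @ zs)" "set (xs @ zs) \<subseteq> {1..24}"
      using len k xs zs Z fin by auto
    then obtain d where d: "d \<in> M" "map d (xs @ zs) = base"
      by (rule to_base)
    have "map d xs = take k base"
      using arg_cong[OF d(2), of "take k"] len by (simp add: take_map)
    then have "d ` X = set (take k base)"
      using xs by (metis set_map)
    then have "set (take k base) \<in> golay_code"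
      using M_code[OF d(1) X(1)] by simp
    moreover have "list_ex (\<lambda>v. odd_meet v (take k base)) golay_vecs"
      using small_check k unfolding base_def by (auto simp: list_all_append)
    ultimately show False
      using not_code[of "take k base"] base_props set_take_subset[of k base] by auto
  next
    case False
    then have "card X = 6" using \<open>\<not> card X > 6\<close> by simp
    obtain xs where xs: "set xs = X" "distinct xs"
      using fin finite_distinct_list by metis
    then have "length xs = 6"
      using distinct_card[OF xs(2)] \<open>card X = 6\<close> by simp
    then obtain x ys where ys: "xs = x # ys" "length ys = 5"
      by (cases xs) auto
    then obtain d where d: "d \<in> M" "map d ys = base"
      using to_base[of ys] xs fin by auto
    have "d ` X = set (d x # base)"
      using xs(1) ys(1) d(2) by (metis list.simps(9) set_map)
    then have code: "set (d x # base) \<in> golay_code"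
      using M_code[OF d(1) X(1)] by simp
    have "d x \<notin> set base"
      using xs(2) ys(1) M_inj[OF d(1)] by (auto simp flip: d(2))
    moreover have "d x \<in> {1..24}"
      using xs ys fin M_in[OF d(1)] by auto
    ultimately have "list_ex (\<lambda>v. odd_meet v (d x # base)) golay_vecs" "distinct (d x # base)"
      "set (d x # base) \<subseteq> {1..24}"
      using small_check base_props by (auto simp: list_all_iff base_def)
    then show False
      using not_code code by blast
  qed
qed

lemma octad_unique:
  assumes X: "X \<in> golay_code" "card X = 8" and Y: "Y \<in> golay_code" "card Y = 8"
    and "card (X \<inter> Y) \<ge> 5"
  shows "X = Y"
proof (rule ccontr)
  assume "X \<noteq> Y"
  then have "card (sym_diff X Y) > 6"
    by (intro min_weight code_sym_diff X Y) blast
  moreover have fin: "finite X" "finite Y"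
    using X Y by (auto intro: card_ge_0_finite)
  have "card (sym_diff X Y) \<le> card (X - Y) + card (Y - X)"
    by (rule card_Un_le)
  moreover have "card (X - Y) = 8 - card (X \<inter> Y)" "card (Y - X) = 8 - card (X \<inter> Y)"
    using X Y fin by (simp_all add: card_Diff_subset_Int Int_commute)
  ultimately show False
    using assms(5) by simp
qed

definition octad :: "bool list \<Rightarrow> bool" where
  "octad v \<longleftrightarrow> length v = 24 \<and> supp v \<in> golay_code \<and> card (supp v) = 8"

text \<open>The image of the octad contains the fixed points of the octad as well, so it shares five
  points with the octad and equals it by \<open>octad_unique\<close>.\<close>

lemma octad_fixed:
  assumes s: "s \<in> M" and v: "octad v" and fs: "\<And>z. z \<in> F \<Longrightarrow> s z = z" "card (F \<inter> supp v) \<ge> 5"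
    and x: "x \<in> {1..24}"
  shows "entry v (s x) = entry v x"
proof -
  have "F \<inter> supp v \<subseteq> s ` supp v \<inter> supp v"
    using fs(1) by (force simp: image_iff)
  moreover have fin: "finite (supp v)"
    by (simp add: supp_def)
  ultimately have "card (s ` supp v \<inter> supp v) \<ge> 5"
    using fs(2) by (meson card_mono finite_Int le_trans)
  moreover have "card (s ` supp v) = 8"
    using v M_inj[OF s] by (subst card_image) (auto simp: octad_def inj_on_def)
  ultimately have "s ` supp v = supp v"
    using v M_code[OF s] by (intro octad_unique) (auto simp: octad_def)
  then have "s x \<in> supp v \<longleftrightarrow> x \<in> supp v"
    using M_inj[OF s] by (metis imageE imageI)
  then show ?thesis
    using x M_in[OF s, of x] by (simp add: supp_def)
qed

text \<open>These octads meet the seven base points in at least five points, and they separate all points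
  except 18 and 21, which are then separated by \<open>octad1\<close>. The five base points first chosen lie in
  \<open>octad0\<close>.\<close>

definition octads :: "bool list list" where
  "octads = map vsum [[4,7,8,9,10], [3,6,7,8,10], [2,7,8,9,11], [1,2,3,12], [1,3,10,11,12],
     [2,3,7,9], [3,5,10], [1,3,4,7,9,10], [2,4,10]]"

definition octad0 :: "bool list" where "octad0 = vsum [1,2,4,6,7,8,10]"
definition octad1 :: "bool list" where "octad1 = vsum [1,2,7]"

lemmas octads_eval = octads_def[unfolded basic_eval vec_eval] octad0_def[unfolded basic_eval vec_eval]
  octad1_def[unfolded basic_eval vec_eval]

lemma card_supp: "card (supp v) = length (filter (entry v) pts)"
  by (metis distinct_card distinct_filter distinct_pts set_filter_entry)

lemma length_eval:
  "length [] = 0" "length [x] = 1" "length (x # y # xs) = length (y # xs) + 1"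
  by simp_all

lemmas num_eval = length_eval one_add_one numeral_plus_one add_num_simps numeral_le_iff le_num_simps
  not_numeral_le_zero zero_neq_numeral numeral_le_one_iff one_le_numeral

lemma octads_check:
  "list_all (\<lambda>v. length v = 24 \<and> spanned golay_basis v \<and> length (filter (entry v) pts) = 8)
    (octad0 # octad1 # octads)"
  by (simp only: octads_eval golay_basis_eval spanned.simps basic_eval vxor_24 num_eval cong:
    weak_congs)

lemma octads: "v \<in> set (octad0 # octad1 # octads) \<Longrightarrow> octad v"
proof -
  assume "v \<in> set (octad0 # octad1 # octads)"
  then have "length v = 24 \<and> spanned golay_basis v \<and> length (filter (entry v) pts) = 8"
    using octads_check unfolding list_all_iff by blast
  then show "octad v"
    using spanned_code[OF golay_basis_code] by (simp add: octad_def card_supp)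
qed

lemma octads_base_check:
  "list_all (\<lambda>v. 5 \<le> length (filter (entry v) (7 # 4 # base))) octads \<and>
   5 \<le> length (filter (entry octad0) base) \<and>
   5 \<le> length (filter (entry octad1) [6, 7, 10, 16, 17, 23, 24])"
  by (simp only: octads_eval base_def basic_eval num_eval cong: weak_congs)

lemma octads_separate:
  "list_all (\<lambda>x. x = 18 \<or> x = 21 \<or>
     (let r = map (\<lambda>v. entry v x) octads in filter (\<lambda>y. map (\<lambda>v. entry v y) octads = r) pts) = [x])
       pts"
  by (simp only: octads_eval basic_eval cong: weak_congs)

lemma card_supp_Int:
  assumes "distinct xs" "set xs \<subseteq> {1..24}"
  shows "card (set xs \<inter> supp v) = length (filter (entry v) xs)"
proof -
  have "set xs \<inter> supp v = set (filter (entry v) xs)"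
    using assms(2) by (auto simp: supp_def)
  then show ?thesis
    using assms(1) by (metis distinct_card distinct_filter)
qed

lemma fixes_seven:
  assumes s: "s \<in> M" and fx: "\<And>z. z \<in> set (7 # 4 # base) \<Longrightarrow> s z = z"
  shows "s = id"
proof -
  \<comment> \<open>Membership in each of the nine octads is preserved, and it identifies every
    point other than 18 and 21.\<close>
  have fixed: "s x = x" if x: "x \<in> {1..24}" "x \<noteq> 18" "x \<noteq> 21" for x
  proof -
    have "entry v (s x) = entry v x" if "v \<in> set octads" for v
    proof (rule octad_fixed[OF s _ fx])
      show "octad v" using octads that by simp
      show "card (set (7 # 4 # base) \<inter> supp v) \<ge> 5"
        using octads_base_check that
        by (subst card_supp_Int) (auto simp: base_def list_all_iff simp del: filter.simps)
    qed (use x in auto)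
    then have "s x \<in> set (filter (\<lambda>y. map (\<lambda>v. entry v y) octads = map (\<lambda>v. entry v x) octads) pts)"
      using M_in[OF s] x by auto
    also have "filter (\<lambda>y. map (\<lambda>v. entry v y) octads = map (\<lambda>v. entry v x) octads) pts = [x]"
      using octads_separate x unfolding list_all_iff Let_def set_pts by blast
    finally show ?thesis by simp
  qed
  \<comment> \<open>\<open>octad1\<close> consists of 18 and the seven points listed below, which
    are already known to be fixed.\<close>
  have e: "entry octad1 (s 18) = entry octad1 18"
  proof (rule octad_fixed[OF s])
    show "octad octad1" using octads by simp
    show "s z = z" if "z \<in> set [6, 7, 10, 16, 17, 23, 24]" for z
      using that by (intro fixed) auto
    show "card (set [6, 7, 10, 16, 17, 23, 24] \<inter> supp octad1) \<ge> 5"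
      using octads_base_check by (subst card_supp_Int) (auto simp del: filter.simps)
  qed simp
  have "entry octad1 18 \<and> \<not> entry octad1 21"
    by (simp only: octads_eval basic_eval)
  then have "s 18 \<noteq> 21"
    using e by metis
  have in24: "s 18 \<in> {1..24}" "s 21 \<in> {1..24}"
    using M_in[OF s] by auto
  have 18: "s 18 = 18"
  proof (rule ccontr)
    assume "s 18 \<noteq> 18"
    then have "s (s 18) = s 18"
      using in24 \<open>s 18 \<noteq> 21\<close> by (intro fixed) auto
    then show False
      using M_inj[OF s] \<open>s 18 \<noteq> 18\<close> by metis
  qed
  have 21: "s 21 = 21"
  proof (rule ccontr)
    assume "s 21 \<noteq> 21"
    moreover have "s 21 \<noteq> 18"
      using M_inj[OF s, of 21 18] 18 by auto
    ultimately have "s (s 21) = s 21"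
      using in24 by (intro fixed) auto
    then show False
      using M_inj[OF s] \<open>s 21 \<noteq> 21\<close> by metis
  qed
  have "s x = id x" for x
    using fixed 18 21 M_out[OF s] by (cases "x \<in> {1..24}") auto
  then show ?thesis by auto
qed

text \<open>\<open>outer\<close> is the complement of \<open>octad0\<close>, and
  \<open>inner\<close> consists of the three points of \<open>octad0\<close> outside
  \<open>base\<close>. The division into halves makes \<open>stab1\<close> and \<open>stab2\<close>
  lists of 8 * 3 = 24 tables, to which the lookup rules for 24 entries apply.\<close>

definition outer1 :: "nat list" where
  "outer1 = [1,2,3,4,5,6,8,9]"

definition outer2 :: "nat list" where
  "outer2 = [10,11,12,13,16,19,20,23]"

definition outer :: "nat list" where
  "outer = outer1 @ outer2"

definition inner :: "nat list" where
  "inner = [7,18,21]"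

definition products :: "nat list \<Rightarrow> nat list list" where
  "products os = concat (map (\<lambda>a. map (\<lambda>b. pcomp (fw W6 a) (fw W7 b)) inner) os)"

definition stab1 :: "nat list list" where "stab1 = products outer1"
definition stab2 :: "nat list list" where "stab2 = products outer2"
definition stab :: "nat list list" where "stab = stab1 @ stab2"

lemmas outer_defs = outer_def outer1_def outer2_def
lemmas stab_defs = stab_def stab1_def stab2_def products_def outer_def

lemma stab_levels: "level [1,2,3,4] 21 W6 4 base outer" "level [1,2,3,4] 13 W7 7 (4 # base) inner"
  by (rule Ws_lengths[THEN level_mono];
      simp only: base_def outer_defs inner_def basic_eval W_evals list.set subset_refl cong:
        weak_congs; simp)+

lemma octad0_check:
  "list_all (\<lambda>x. elem x base \<or> entry octad0 x = elem x inner \<and> entry octad0 x = (\<not> elem x outer)) pts"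
  by (simp only: base_def outer_defs inner_def octads_eval basic_eval cong: weak_congs)

text \<open>The element is sifted through two more levels. It preserves \<open>octad0\<close>, so 4
  stays in the complement; once 4 is fixed, 7 stays in \<open>inner\<close>, and what remains is
  trivial by \<open>fixes_seven\<close>. The bound 34 is 21 + 13.\<close>

lemma stab:
  assumes s: "s \<in> M" and fx: "\<And>z. z \<in> set base \<Longrightarrow> s z = z"
  obtains p w where "p \<in> set stab" "length p = 24" "act p = s" "s = wfun gf w" "length w \<le> 34"
    "set w \<subseteq> {1,2,3,4}"
proof -
  have e: "entry octad0 (s x) = entry octad0 x" if "x \<in> {1..24}" for x
  proof (rule octad_fixed[OF s _ fx])
    show "octad octad0" using octads by simp
    show "card (set base \<inter> supp octad0) \<ge> 5"
      using octads_base_check base_props by (subst card_supp_Int) auto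
  qed (use that in auto)
  have nb: "s x \<notin> set base" if "x \<notin> set base" for x
    using that fx M_inj[OF s] by metis
  have io: "4 \<in> set outer" "7 \<in> set inner" "set outer \<subseteq> {1..24}" "set inner \<subseteq> {1..24}" "4 \<notin> set
    base" "7 \<notin> set base"
    by (auto simp: outer_defs inner_def base_def)
  have chk: "x \<in> {1..24} \<Longrightarrow> x \<notin> set base \<Longrightarrow> entry octad0 x \<longleftrightarrow> x \<in> set inner"
    "x \<in> {1..24} \<Longrightarrow> x \<notin> set base \<Longrightarrow> entry octad0 x \<longleftrightarrow> x \<notin> set outer" for x
    using octad0_check unfolding list_all_iff set_pts elem_iff by blast+
  have a: "s 4 \<in> set outer"
    using chk(2)[of "s 4"] chk(2)[of 4] e[of 4] io M_in[OF s, of 4] nb[of 4] by auto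
  then have a24: "s 4 \<in> {1..24}" using io by auto
  note l6 = levelD[OF stab_levels(1) _ a a24]
  have L: "set [1,2,3,4] \<subseteq> {1..6::nat}" by auto
  define s1 where "s1 = act (bk W6 (s 4)) \<circ> s"
  have s1: "s1 \<in> M" unfolding s1_def by (intro M_comp s l6(7) L)
  have fix1: "s1 z = z" if "z \<in> set (4 # base)" for z
    using that l6(12,13)[OF L] fx by (auto simp: s1_def)
  have e1: "entry octad0 (s1 x) = entry octad0 x" if "x \<in> {1..24}" for x
  proof (rule octad_fixed[OF s1])
    show "octad octad0" using octads by simp
    show "card (set base \<inter> supp octad0) \<ge> 5"
      using octads_base_check base_props by (subst card_supp_Int) auto
  qed (use that fix1 in auto)
  have "s1 7 \<notin> set base"
    using fix1 M_inj[OF s1] io by (metis list.set_intros(2))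
  then have b: "s1 7 \<in> set inner"
    using chk(1)[of "s1 7"] chk(1)[of 7] e1[of 7] io M_in[OF s1, of 7] by auto
  then have b24: "s1 7 \<in> {1..24}" using io by auto
  note l7 = levelD[OF stab_levels(2) L b b24]
  define s2 where "s2 = act (bk W7 (s1 7)) \<circ> s1"
  have "s2 = id"
  proof (rule fixes_seven)
    show "s2 \<in> M" unfolding s2_def by (intro M_comp s1 l7(7))
    show "s2 z = z" if "z \<in> set (7 # 4 # base)" for z
    proof (cases "z = 7")
      case True
      then show ?thesis unfolding s2_def using l7(12) by simp
    next
      case False
      then have "z \<in> set (4 # base)" using that by simp
      then show ?thesis unfolding s2_def using l7(13) fix1 by simp
    qed
  qed
  have "act (fw W6 (s 4)) \<circ> act (fw W7 (s1 7)) \<circ> s2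
      = act (fw W6 (s 4)) \<circ> (act (fw W7 (s1 7)) \<circ> act (bk W7 (s1 7))) \<circ> s1"
    unfolding s2_def by (simp only: o_assoc)
  also have "\<dots> = act (fw W6 (s 4)) \<circ> s1"
    unfolding l7(9) comp_id ..
  also have "\<dots> = (act (fw W6 (s 4)) \<circ> act (bk W6 (s 4))) \<circ> s"
    unfolding s1_def by (simp only: o_assoc)
  also have "\<dots> = s"
    unfolding l6(9)[OF L] by (rule id_comp)
  finally have s_eq: "act (fw W6 (s 4)) \<circ> act (fw W7 (s1 7)) = s"
    unfolding \<open>s2 = id\<close> comp_id .
  show ?thesis
  proof (rule that)
    let ?p = "pcomp (fw W6 (s 4)) (fw W7 (s1 7))"
    show "?p \<in> set stab" using a b by (auto simp: stab_defs)
    show "length ?p = 24" using l7(1) by simp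
    show "act ?p = s" using l6(1)[OF L] l7(1) s_eq by (simp only: act_pcomp)
    show "s = wfun gf (entry W6 (s 4) @ entry W7 (s1 7))"
      unfolding wfun_append l6(3)[OF L, symmetric] l7(3)[symmetric] by (rule s_eq[symmetric])
    show "length (entry W6 (s 4) @ entry W7 (s1 7)) \<le> 34" using l6(5)[OF L] l7(5) by simp
    show "set (entry W6 (s 4) @ entry W7 (s1 7)) \<subseteq> {1,2,3,4}" using l6(4)[OF L] l7(4) by auto
  qed
qed

lemma entry_24_def:
  assumes "xs = [x1, x2, x3, x4, x5, x6, x7, x8, x9, x10, x11, x12, x13, x14, x15, x16, x17, x18,
    x19, x20, x21, x22, x23, x24]"
  shows
    "entry xs 1 = x1"
    "entry xs 2 = x2"
    "entry xs 3 = x3"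
    "entry xs 4 = x4"
    "entry xs 5 = x5"
    "entry xs 6 = x6"
    "entry xs 7 = x7"
    "entry xs 8 = x8"
    "entry xs 9 = x9"
    "entry xs 10 = x10"
    "entry xs 11 = x11"
    "entry xs 12 = x12"
    "entry xs 13 = x13"
    "entry xs 14 = x14"
    "entry xs 15 = x15"
    "entry xs 16 = x16"
    "entry xs 17 = x17"
    "entry xs 18 = x18"
    "entry xs 19 = x19"
    "entry xs 20 = x20"
    "entry xs 21 = x21"
    "entry xs 22 = x22"
    "entry xs 23 = x23"
    "entry xs 24 = x24"
  using assms by (simp_all only: entry_24)

lemmas stab_eval =
  entry_24_def[OF stab1_def[unfolded products_def outer1_def inner_def basic_eval W_evals
    concat.simps]]
  entry_24_def[OF stab2_def[unfolded products_def outer2_def inner_def basic_eval W_evals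
    concat.simps]]

lemma stab_entries: "set stab = entry stab1 ` set pts \<union> entry stab2 ` set pts"
proof -
  have "set xs = entry xs ` set pts" if "length xs = 24" for xs :: "nat list list"
  proof -
    have "set xs = (!) xs ` {..<24}"
      using that by (auto simp: in_set_conv_nth image_iff)
    also have "{..<24} = (\<lambda>i. i - 1) ` set pts"
      by (auto simp: image_iff intro!: bexI[of _ "Suc x" for x])
    finally show ?thesis
      by (simp add: image_image entry_def)
  qed
  moreover have "length stab1 = 24" "length stab2 = 24"
    by (simp_all add: stab1_def stab2_def products_def outer1_def outer2_def inner_def)
  ultimately show ?thesis by (simp add: stab_def)
qed

section \<open>Permutations with prescribed values\<close>

primrec agree :: "nat list list \<Rightarrow> (nat \<times> nat) list \<Rightarrow> nat \<Rightarrow> bool" where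
  "agree S [] i = True"
| "agree S (q # qs) i = (if act (entry S i) (fst q) = snd q then agree S qs i else False)"

lemma agree_eq: "agree S qs = (\<lambda>i. \<forall>(x, y)\<in>set qs. act (entry S i) x = y)"
  by (induction qs) (auto simp: fun_eq_iff)

text \<open>The empty list is split off so that the tables \<open>d\<close> and \<open>u\<close> are
  computed only if some element has been selected.\<close>

primrec build :: "nat list \<Rightarrow> nat list \<Rightarrow> nat list list \<Rightarrow> nat list list" where
  "build cx cy [] = []"
| "build cx cy (p # ps) =
     (let d = map (down Ws cx) pts; u = up Ws cy pts in map (\<lambda>p. pcomp u (pcomp p d)) (p # ps))"

fun dist :: "'a list \<Rightarrow> bool" where
  "dist [] = True"
| "dist (x # xs) = (\<not> elem x xs \<and> dist xs)"

lemma dist_iff [simp]: "dist xs \<longleftrightarrow> distinct xs"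
  by (induction xs) auto

text \<open>If \<open>d\<close> and \<open>e\<close> move the five sources and the five targets to the base, then a solution \<open>f\<close>
  gives an element \<open>e f d\<^sup>-\<^sup>1\<close> of the stabiliser of the base, which is one of the 48 known ones. The
  remaining pairs select among these.\<close>

fun candidates :: "(nat \<times> nat) list \<Rightarrow> nat list list" where
  "candidates (p1 # p2 # p3 # p4 # p5 # ps) =
     (let cx = coords Ws (map fst [p1, p2, p3, p4, p5]); cy = coords Ws (map snd [p1, p2, p3, p4,
       p5]);
          qs = map (\<lambda>(x, y). (down Ws cx x, down Ws cy y)) ps
      in build cx cy
        (map (entry stab1) (filter (agree stab1 qs) pts) @
         map (entry stab2) (filter (agree stab2 qs) pts)))"
| "candidates _ = []"

fun five :: "'a list \<Rightarrow> bool" where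
  "five (p1 # p2 # p3 # p4 # p5 # ps) = True"
| "five _ = False"

fun sources_ok :: "(nat \<times> nat) list \<Rightarrow> bool" where
  "sources_ok (p1 # p2 # p3 # p4 # p5 # ps) = dist (map fst [p1, p2, p3, p4, p5])"
| "sources_ok _ = False"

fun targets_ok :: "(nat \<times> nat) list \<Rightarrow> bool" where
  "targets_ok (p1 # p2 # p3 # p4 # p5 # ps) = dist (map snd [p1, p2, p3, p4, p5])"
| "targets_ok _ = False"

text \<open>Distinct sources are an obligation on the query. Coinciding targets mean that no
  permutation takes these values, so the answer is then vacuously positive.\<close>

definition all_ext :: "(nat list \<Rightarrow> bool) \<Rightarrow> (nat \<times> nat) list \<Rightarrow> bool" where
  "all_ext Q ps \<longleftrightarrow> sources_ok ps \<and> (targets_ok ps \<longrightarrow> list_all Q (candidates ps))"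

lemma five_points:
  assumes "length xs = 5" "distinct xs" "set xs \<subseteq> {1..24}"
  obtains w where "set w \<subseteq> {1..6}" "wfun gf w \<in> M" "wfun gf w \<circ> down Ws (coords Ws xs) = id"
    "down Ws (coords Ws xs) \<circ> wfun gf w = id" "down Ws (coords Ws xs) \<in> M"
    "map (down Ws (coords Ws xs)) xs = base"
    "length (up Ws (coords Ws xs) pts) = 24" "act (up Ws (coords Ws xs) pts) = wfun gf w"
proof -
  have xs: "set xs \<subseteq> {1..24} - set []" "length xs = length Ws" and L: "set [1,2,3,4,5] \<subseteq> {1..6::nat}"
    using assms by (auto simp: Ws_def)
  obtain w where w: "set w \<subseteq> set [1,2,3,4,5]" "wfun gf w \<circ> down Ws (coords Ws xs) = id"
    "down Ws (coords Ws xs) \<circ> wfun gf w = id" "down Ws (coords Ws xs) \<in> M"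
    "map (down Ws (coords Ws xs)) xs = base"
    "\<And>p. length p = 24 \<Longrightarrow> length (up Ws (coords Ws xs) p) = 24"
    "\<And>p. length p = 24 \<Longrightarrow> act (up Ws (coords Ws xs) p) = wfun gf w \<circ> act p"
    by (rule chain[OF valid_Ws xs(2) assms(2) xs(1) L], blast)
  have "set w \<subseteq> {1..6}"
    using w(1) L by blast
  then show ?thesis
    using that[of w] w(2-5) w(6)[of pts] w(7)[of pts] wtab_gens(3) by simp
qed

lemma build_cases: "q \<in> set (build cx cy ps) \<longleftrightarrow>
    (\<exists>p\<in>set ps. q = pcomp (up Ws cy pts) (pcomp p (map (down Ws cx) pts)))"
  by (cases ps) (auto simp: Let_def)

lemma selection:
  "set (map (entry stab1) (filter (agree stab1 qs) pts) @ map (entry stab2) (filter (agree stab2 qs)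
    pts)) =
   {p \<in> set stab. \<forall>(x, y)\<in>set qs. act p x = y}"
  unfolding stab_entries agree_eq by auto

lemma act_map_pts: "f \<in> M \<Longrightarrow> act (map f pts) = f"
  using M_out[of f] by (force simp: act_def entry_def pts_upt fun_eq_iff)

lemma stab_M:
  assumes "p \<in> set stab"
  shows "length p = 24" "act p \<in> M"
proof -
  obtain a b where ab: "a \<in> set outer" "b \<in> set inner" "p = pcomp (fw W6 a) (fw W7 b)"
    using assms by (auto simp: stab_defs)
  have L: "set [1,2,3,4] \<subseteq> {1..6::nat}" "a \<in> {1..24}" "b \<in> {1..24}"
    using ab by (auto simp: outer_defs inner_def)
  note a = levelD[OF stab_levels(1) L(1) ab(1) L(2)] and b = levelD[OF stab_levels(2) L(1) ab(2) L(3)]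
  show "length p = 24" "act p \<in> M"
    using ab(3) a(1) b(1) M_comp[OF a(6) b(6)] by (simp_all add: act_pcomp)
qed

text \<open>Soundness of a query: the tables it produces lie in the group. This is needed where a
  conjugating element is taken from a query.\<close>

lemma candidates_M:
  assumes "sources_ok ps" "targets_ok ps" "q \<in> set (candidates ps)" "set ps \<subseteq> {1..24} \<times> {1..24}"
  shows "length q = 24" "act q \<in> M"
proof -
  obtain p1 p2 p3 p4 p5 rest where ps: "ps = p1 # p2 # p3 # p4 # p5 # rest"
    using assms(1) by (cases ps rule: sources_ok.cases) auto
  define xs ys where "xs = map fst [p1, p2, p3, p4, p5]" and "ys = map snd [p1, p2, p3, p4, p5]"
  have xs: "length xs = 5" "distinct xs" and ys: "length ys = 5" "distinct ys"
    using assms(1,2) by (simp_all add: ps xs_def ys_def)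
  have "fst p \<in> {1..24} \<and> snd p \<in> {1..24}" if "p \<in> set ps" for p
    using assms(4) that by (cases p) auto
  then have xs24: "set xs \<subseteq> {1..24}" and ys24: "set ys \<subseteq> {1..24}"
    unfolding xs_def ys_def ps by simp_all
  note xs = xs xs24 and ys = ys ys24
  obtain p where p: "p \<in> set stab" "q = pcomp (up Ws (coords Ws ys) pts) (pcomp p (map (down Ws
    (coords Ws xs)) pts))"
    using assms(3) unfolding ps candidates.simps xs_def[symmetric] ys_def[symmetric] Let_def
      build_cases selection
    by blast
  obtain w where w: "down Ws (coords Ws xs) \<in> M"
    by (rule five_points[OF xs], blast)
  obtain v where v: "wfun gf v \<in> M" "length (up Ws (coords Ws ys) pts) = 24" "act (up Ws (coords Ws
    ys) pts) = wfun gf v"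
    by (rule five_points[OF ys], blast)
  show "length q = 24" "act q \<in> M"
    using stab_M[OF p(1)] w v unfolding p(2)
    by (simp_all add: act_pcomp act_map_pts M_comp)
qed

lemma candidates:
  assumes f: "f \<in> M" "\<And>x y. (x, y) \<in> set ps \<Longrightarrow> x \<in> {1..24} \<and> f x = y"
    and Q: "all_ext Q ps"
  obtains p where "length p = 24" "act p = f" "Q p"
proof -
  obtain p1 p2 p3 p4 p5 rest where ps: "ps = p1 # p2 # p3 # p4 # p5 # rest"
    using Q by (cases ps rule: sources_ok.cases) (auto simp: all_ext_def)
  define xs ys where "xs = map fst [p1, p2, p3, p4, p5]" and "ys = map snd [p1, p2, p3, p4, p5]"
  have f2: "fst p \<in> {1..24} \<and> f (fst p) = snd p" if "p \<in> set ps" for p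
    using f(2)[of "fst p" "snd p"] that by simp
  then have ys_eq: "ys = map f xs"
    by (simp add: xs_def ys_def ps)
  have xs: "length xs = 5" "distinct xs" "set xs \<subseteq> {1..24}"
    using Q f2 by (simp_all add: ps xs_def all_ext_def)
  have ys: "length ys = 5" "distinct ys" "set ys \<subseteq> {1..24}"
    using xs M_in[OF f(1)] M_inj[OF f(1)] by (auto simp: ys_eq distinct_map inj_on_def)
  obtain w where w: "wfun gf w \<in> M" "wfun gf w \<circ> down Ws (coords Ws xs) = id"
    "down Ws (coords Ws xs) \<circ> wfun gf w = id" "down Ws (coords Ws xs) \<in> M"
    "map (down Ws (coords Ws xs)) xs = base"
    by (rule five_points[OF xs], blast)
  obtain v where v: "wfun gf v \<in> M" "wfun gf v \<circ> down Ws (coords Ws ys) = id"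
    "down Ws (coords Ws ys) \<in> M" "map (down Ws (coords Ws ys)) ys = base"
    "length (up Ws (coords Ws ys) pts) = 24" "act (up Ws (coords Ws ys) pts) = wfun gf v"
    by (rule five_points[OF ys], blast)
  define d e where "d = down Ws (coords Ws xs)" and "e = down Ws (coords Ws ys)"
  have wd: "wfun gf w (d z) = z" and ve: "wfun gf v (e z) = z" for z
    using fun_cong[OF w(2)] fun_cong[OF v(2)] by (simp_all add: d_def e_def)
  \<comment> \<open>\<open>wfun gf w\<close> is the inverse of \<open>d\<close>, so \<open>s\<close>
    leads from the base to the sources, to the targets and back to the base.\<close>
  define s where "s = e \<circ> f \<circ> wfun gf w"
  have s: "s \<in> M"
    unfolding s_def using w(1) v(3) f(1) by (intro M_comp) (simp_all add: e_def)
  have sd: "s (d z) = e (f z)" for z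
    by (simp add: s_def wd)
  have "map s base = map s (map d xs)"
    using w(5) by (simp add: d_def)
  also have "\<dots> = map e (map f xs)"
    by (simp add: sd)
  also have "\<dots> = base"
    using v(4) by (simp add: e_def ys_eq)
  finally have "s z = z" if "z \<in> set base" for z
    using that by (simp add: list_eq_iff_nth_eq in_set_conv_nth) metis
  then obtain p where p: "p \<in> set stab" "length p = 24" "act p = s"
    using stab[OF s] by metis
  let ?q = "pcomp (up Ws (coords Ws ys) pts) (pcomp p (map d pts))"
  have "\<forall>(x, y)\<in>set (map (\<lambda>(x, y). (d x, e y)) rest). act p x = y"
    using f2 by (force simp: p(3) sd ps)
  then have "?q \<in> set (candidates ps)"
    using p(1) unfolding ps candidates.simps xs_def[symmetric] ys_def[symmetric] Let_def build_cases
      selection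
      d_def e_def
    by blast
  moreover have "targets_ok ps"
    using ys(2) by (simp add: ps ys_def)
  ultimately have "Q ?q"
    using Q by (auto simp: all_ext_def list_all_iff)
  moreover have "length ?q = 24"
    by simp
  moreover have "act ?q = wfun gf v \<circ> (s \<circ> d)"
    using p v(5,6) w(4) by (simp add: act_pcomp act_map_pts d_def)
  then have "act ?q = f"
    by (auto simp: sd ve)
  ultimately show ?thesis using that by blast
qed

section \<open>Involutions in a centraliser\<close>

definition ins :: "'a \<Rightarrow> 'a list \<Rightarrow> 'a list" where
  "ins q ps = (if elem q ps then ps else ps @ [q])"

text \<open>If f x = y, then f y = x because f is an involution, and f (r x) = r y and f (r y) = r x
  because f commutes with r.\<close>

definition adjoin :: "nat list \<Rightarrow> nat \<Rightarrow> nat \<Rightarrow> (nat \<times> nat) list \<Rightarrow> (nat \<times> nat) list" where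
  "adjoin r x y ps = ins (act r y, act r x) (ins (act r x, act r y) (ins (y, x) (ins (x, y) ps)))"

text \<open>Search for the involutions commuting with \<open>r\<close>: every choice of an image is closed under both
  relations.\<close>

primrec search :: "(nat list \<Rightarrow> bool) \<Rightarrow> nat list \<Rightarrow> nat list \<Rightarrow> (nat \<times> nat) list \<Rightarrow> bool" where
  "search Q r [] ps = all_ext Q ps"
| "search Q r (x # xs) ps =
     (if five ps \<or> elem x (map fst ps) then search Q r xs ps
      else list_all (\<lambda>y. elem y (map snd ps) \<or>
        (let ps' = adjoin r x y ps in
          dist (map fst ps') \<and> dist (map snd ps') \<longrightarrow> search Q r xs ps')) pts)"

lemma set_ins [simp]: "set (ins q ps) = insert q (set ps)"
  by (auto simp: ins_def)

lemma distinct_ins [simp]: "distinct (ins q ps) \<longleftrightarrow> distinct ps"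
  by (auto simp: ins_def)

lemma search:
  assumes f: "f \<in> M" "f \<circ> f = id" "f \<circ> act r = act r \<circ> f" and r: "act r \<in> M"
    and "search Q r xs ps" "distinct ps" "\<And>x y. (x, y) \<in> set ps \<Longrightarrow> x \<in> {1..24} \<and> f x = y"
    and "set xs \<subseteq> {1..24}"
  shows "\<exists>p. length p = 24 \<and> act p = f \<and> Q p"
  using assms(5-8)
proof (induction xs arbitrary: ps)
  case Nil
  then show ?case using candidates[OF f(1), of ps Q] by (metis search.simps(1))
next
  case (Cons x xs)
  show ?case
  proof (cases "five ps \<or> elem x (map fst ps)")
    case True
    then show ?thesis using Cons.IH[of ps] Cons.prems by simp
  next
    case False
    let ?ps = "adjoin r x (f x) ps"
    have ff: "f (f z) = z" and fr: "f (act r z) = act r (f z)" for z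
      using fun_cong[OF f(2), of z] fun_cong[OF f(3), of z] by simp_all
    have x: "x \<in> {1..24}" "f x \<in> {1..24}"
      using Cons.prems(4) M_in[OF f(1)] by auto
    have fx: "f x \<notin> snd ` set ps"
    proof
      assume "f x \<in> snd ` set ps"
      then obtain u where "(u, f x) \<in> set ps" by auto
      moreover from this have "u = x"
        using Cons.prems(3) M_inj[OF f(1)] by auto
      ultimately show False using False by force
    qed
    have d: "distinct ?ps"
      using Cons.prems(2) by (simp add: adjoin_def)
    have g: "u \<in> {1..24} \<and> f u = v" if "(u, v) \<in> set ?ps" for u v
      using that Cons.prems(3) x M_in[OF r] by (auto simp: adjoin_def ff fr)
    have g': "snd u = f (fst u)" if "u \<in> set ?ps" for u
      using g[of "fst u" "snd u"] that by simp
    have "inj_on fst (set ?ps)"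
      by (intro inj_onI prod_eqI) (simp_all add: g')
    moreover have "inj_on snd (set ?ps)"
    proof (rule inj_onI)
      fix u v assume uv: "u \<in> set ?ps" "v \<in> set ?ps" "snd u = snd v"
      then have "fst u = fst v"
        using M_inj[OF f(1), of "fst u" "fst v"] g' by simp
      then show "u = v"
        using uv(3) by (rule prod_eqI)
    qed
    ultimately have "distinct (map fst ?ps)" "distinct (map snd ?ps)"
      using d by (simp_all add: distinct_map)
    with fx have "search Q r xs ?ps"
      using Cons.prems(1) False x(2) by (auto simp: list_all_iff Let_def)
    then show ?thesis
      by (rule Cons.IH[OF _ d g]) (use Cons.prems(4) in auto)
  qed
qed

section \<open>Equations between words, checked point by point\<close>

definition sat :: "nat list list \<Rightarrow> nat list \<Rightarrow> nat list \<Rightarrow> bool" where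
  "sat ts w v \<longleftrightarrow> list_all (\<lambda>x. run ts w x = run ts v x) pts"

lemma wfun_M: "(\<And>i. i \<in> set w \<Longrightarrow> s i \<in> M) \<Longrightarrow> wfun s w \<in> M"
  by (induction w) (auto simp: M_id intro!: M_comp)

lemma run_wfun: "(\<And>i. i \<in> set w \<Longrightarrow> act (entry ts i) = s i) \<Longrightarrow> run ts w x = wfun s w x"
  by (induction w) auto

lemma wfun_out: "(\<And>i. i \<in> set w \<Longrightarrow> s i x = x) \<Longrightarrow> wfun s w x = x"
  by (induction w) auto

lemma sat_iff:
  assumes "\<And>i. i \<in> set w \<union> set v \<Longrightarrow> act (entry ts i) = s i"
    and "\<And>i x. i \<in> set w \<union> set v \<Longrightarrow> x \<notin> {1..24} \<Longrightarrow> s i x = x"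
  shows "sat ts w v \<longleftrightarrow> wfun s w = wfun s v"
proof -
  have "sat ts w v \<longleftrightarrow> (\<forall>x\<in>{1..24}. wfun s w x = wfun s v x)"
    unfolding sat_def list_all_iff set_pts using assms(1) run_wfun[of w ts s] run_wfun[of v ts s] by
      simp
  also have "\<dots> \<longleftrightarrow> wfun s w = wfun s v"
    using wfun_out[of w s] wfun_out[of v s] assms(2) by (metis UnI1 UnI2 ext)
  finally show ?thesis .
qed

lemma run_commute:
  "(\<And>i z. i \<in> set w \<Longrightarrow> f (act (entry ts i) z) = act (entry ts i) (f z)) \<Longrightarrow>
    f (run ts w x) = run ts w (f x)"
  by (induction w) auto

lemmas search_eval = agree.simps build.simps dist.simps candidates.simps five.simps sources_ok.simps
  targets_ok.simps all_ext_def ins_def adjoin_def search.simps sat_def prod.inject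
  coords.simps down.simps up.simps Ws_def

section \<open>Computations for the classification\<close>

lemma entry_small:
  "entry [x1] 1 = x1" "entry [x1, x2] 1 = x1" "entry [x1, x2] 2 = x2"
  "entry [x1, x2, x3, x4] 3 = x3" "entry [x1, x2, x3, x4] 4 = x4"
  "entry [x1, x2, x3] 1 = x1" "entry [x1, x2, x3] 2 = x2" "entry [x1, x2, x3] 3 = x3"
  by (simp_all add: entry_def)

definition rot :: "nat list" where "rot = pcomp (entry gens 2) (entry gens 3)"

lemmas rot_eval = rot_def[unfolded gens_eval basic_eval]

definition powers :: "nat list list" where
  "powers = [[], [1], [1,1], [1,1,1], [1,1,1,1], [1,1,1,1,1], [1,1,1,1,1,1], [1,1,1,1,1,1,1],
     [1,1,1,1,1,1,1,1], [1,1,1,1,1,1,1,1,1]]"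

definition order_10 :: "nat list \<Rightarrow> bool" where
  "order_10 p \<longleftrightarrow> sat [p] [1,1,1,1,1,1,1,1,1,1] [] \<and> \<not> sat [p] [1,1] [] \<and> \<not> sat [p] [1,1,1,1,1] []"

text \<open>An element that conjugates p to \<open>rot\<close> and fixes 23 sends p^k 23 to rot^k
  23; these ten pairs form the query. The conditions on sources and targets are those of
  \<open>candidates_M\<close>.\<close>

definition conj_rot :: "nat list \<Rightarrow> bool" where
  "conj_rot p \<longleftrightarrow> (let ps = map (\<lambda>w. (run [p] w 23, run [rot] w 23)) powers in
     sources_ok ps \<and> targets_ok ps \<and> list_ex (\<lambda>f. pcomp f p = pcomp rot f) (candidates ps))"

definition check_rot :: "nat list \<Rightarrow> bool" where
  "check_rot p \<longleftrightarrow> (order_10 p \<longrightarrow> conj_rot p)"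

lemmas rot_simps = order_10_def conj_rot_def check_rot_def powers_def rot_eval entry_small gens_eval

text \<open>The 10-cycle of \<open>rot\<close> through 23 begins with 23, 8, 17, 13, 4. Permutations
  with the same first four steps are examined for every image \<open>y\<close> of 4 that injectivity
  permits.\<close>

lemma rot_check:
  "list_all (\<lambda>y. elem y [8,17,13,4] \<or>
      all_ext check_rot [(23,8), (8,17), (17,13), (13,4), (4,y)]) pts"
  by (simp only: rot_simps search_eval basic_eval W_evals stab_eval cong: weak_congs)

definition check_five :: "nat list \<Rightarrow> bool" where
  "check_five p \<longleftrightarrow> (sat [p, rot] [1,2] [2,1] \<and> sat [p] [1,1] [] \<and> \<not> sat [p] [1] [] \<and>
     \<not> sat [p, rot] [1] [2,2,2,2,2] \<longrightarrow> p = entry gens 5 \<or> p = entry gens 6)"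

text \<open>An element commuting with \<open>rot\<close> is determined on the 10-cycle of 23 by the
  image of 23. The fifth power of \<open>rot\<close> is excluded in \<open>check_five\<close>,
  because the fifth generator is not a word in the second and the third.\<close>

lemma five_check:
  "list_all (\<lambda>y. all_ext check_five (map (\<lambda>w. (run [rot] w 23, run [rot] w y)) powers)) pts"
  by (simp only: check_five_def rot_simps search_eval basic_eval W_evals stab_eval cong: weak_congs)

text \<open>The involutions inverting \<open>rot\<close> fall into four classes under conjugation by powers of \<open>rot\<close>.\<close>

definition reflections :: "nat list list" where
  "reflections = [entry gens 2, entry gens 3,
     [18,15,14,21,20,16,19,24,13,23,17,22,9,3,2,6,11,1,7,5,4,12,10,8],
     [20,22,10,5,4,14,18,11,17,3,8,15,21,6,12,19,9,7,16,1,13,2,24,23]]"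

text \<open>Exponents up to 4 suffice for the conjugators: the fifth power of \<open>rot\<close> is
  its own inverse and therefore commutes with every involution inverting \<open>rot\<close>.\<close>

definition check_two :: "nat list \<Rightarrow> bool" where
  "check_two p \<longleftrightarrow> (sat [p, rot] [1,1] [] \<and> sat [p, rot] [1,2,1,2] [] \<longrightarrow>
     list_ex (\<lambda>r. list_ex (\<lambda>c. sat [p, rot, r] (c @ [1]) (3 # c)) [[], [2], [2,2], [2,2,2],
       [2,2,2,2]])
       reflections)"

text \<open>If f inverts \<open>rot\<close>, then f (rot^k 23) = rot^(10-k) (f 23). Hence
  \<open>powers\<close> is paired with its reverse, the exponent 0 staying in front.\<close>

lemma two_check:
  "list_all (\<lambda>y. all_ext check_two (map2 (\<lambda>w v. (run [rot] w 23, run [rot] v y))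
      powers ([] # rev (tl powers)))) pts"
  by (simp only: check_two_def reflections_def rot_simps search_eval basic_eval list.sel zip.simps
    list.case W_evals
      stab_eval cong: weak_congs)

text \<open>The solutions of the relations that do not generate the whole group generate groups of order
  3840 or 190080. In the first case the last generator is one of the words \<open>word_a\<close>, \<open>word_b\<close> in the
  second to fourth ones, in the second case the first generator is \<open>word_c\<close> in the others. Both
  contradict the intersection property.\<close>

definition word_a :: "nat list" where
  "word_a = [2,3,2,3,2,3,2,3,2,4,3,2,3,2,3,2,3,4,3,2,3,2,4,3,2,3,2,3,4]"
definition word_b :: "nat list" where
  "word_b = [3,4,3,2,3,2,3,2,3,4,3,2,3,2,4,3,2,3,2,3,4]"
definition word_c :: "nat list" where
  "word_c = [2,3,2,4,3,2,3,2,3,5,4,3,2,3,2,3,4,3,2,3,2,3,2,5,4,3,2]"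

text \<open>The four conjugators commute with the second, third, fifth and sixth entries of
  \<open>gens\<close>. They are the freedom left once the second, third and fifth generators agree
  with those of the standard string.\<close>

definition check_one ::
  "nat list \<Rightarrow> nat list \<Rightarrow> nat list \<Rightarrow> nat list \<Rightarrow> nat \<Rightarrow> nat list \<Rightarrow> bool" where
  "check_one t2 t3 t4 t5 j p \<longleftrightarrow>
     (let ts = [p, t2, t3, t4, t5] in
      sat ts [1,1] [] \<and> sat ts [1,3] [3,1] \<and> sat ts [1,4] [4,1] \<and> sat ts [1,5] [5,1] \<and>
      sat ts [1,2,1,2,1,2,1,2] [] \<and> \<not> sat ts [1] [] \<and> \<not> sat ts [1] word_c \<longrightarrow>
      list_ex (\<lambda>c. list_all (\<lambda>(i, k). pcomp c (entry ts i) = pcomp (entry gens k) c)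
          [(1,1), (2,2), (3,3), (4,4), (5,j)])
        [pts, entry gens 5, entry gens 6, pcomp (entry gens 5) (entry gens 6)])"

text \<open>The first generator commutes with \<open>t3\<close>, \<open>t4\<close> and \<open>t5\<close>, so that it is determined on the orbit
  of \<open>x\<close> under these by the image of \<open>x\<close>. The words \<open>ws\<close> lead to sufficiently many points of this
  orbit.\<close>

definition check_last ::
  "nat list \<Rightarrow> nat list \<Rightarrow> nat list \<Rightarrow> nat \<Rightarrow> nat \<Rightarrow> nat list list \<Rightarrow> nat \<Rightarrow> bool" where
  "check_last t2 t3 t4 k x ws j \<longleftrightarrow>
     (let ts = [pts, t2, t3, t4, entry gens k] in
      sat ts (if j = 5 then [4,5,4,5,4,5,4,5] else [4,5,4,5,4,5]) [] \<and> \<not> sat ts [4,5,4,5] [] \<and>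
      \<not> sat ts [5] word_a \<and> \<not> sat ts [5] word_b \<longrightarrow>
      list_all (\<lambda>y. all_ext (check_one t2 t3 t4 (entry gens k) j)
        (map (\<lambda>w. (run ts w x, run ts w y)) ws)) pts)"

text \<open>Identity tables stand in for the generators not yet known, so that letters keep their
  numbers. \<open>s5\<close> and \<open>s6\<close> hold the starting point and the words for the two
  choices of the fifth generator.\<close>

definition check_four :: "nat list \<Rightarrow> nat \<times> nat list list \<Rightarrow> nat \<times> nat list list \<Rightarrow> nat list \<Rightarrow> bool"
  where
  "check_four t2 s5 s6 p \<longleftrightarrow> (let t3 = pcomp t2 rot; ts = [pts, t2, t3, p, pts] in
     sat ts [3,4,3,4,3,4] [] \<and> sat ts [4,4] [] \<and> sat ts [2,4] [4,2] \<longrightarrow>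
     list_all (\<lambda>(k, x, ws). list_all (check_last t2 t3 p k x ws) [5,6]) [(5, s5), (6, s6)])"

lemmas check_simps = check_one_def check_last_def check_four_def word_a_def word_b_def word_c_def

lemma four_check_1:
  "search (check_four (entry gens 2) (3, [[], [3], [4], [5], [3,4], [3,5], [4,3]])
      (1, [[], [3], [5], [3,5], [4,3,5,4], [3,4,3,5,4], [4,3,5,4,3]])) (entry gens 2) [1,5,6] []"
  by (simp only: check_simps rot_simps search_eval basic_eval W_evals stab_eval cong: weak_congs)

text \<open>The pair \<open>(1, [])\<close> is a placeholder. A query without pairs fails
  \<open>sources_ok\<close>, so the check can succeed only because no fourth generator meets the
  premises of \<open>check_four\<close> and \<open>check_last\<close>. The same applies to
  \<open>four_check_4\<close>.\<close>

lemma four_check_2: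
  "search (check_four (entry gens 3) (1, []) (1, [])) (entry gens 3) [1,2,3] []"
  by (simp only: check_simps rot_simps search_eval basic_eval W_evals stab_eval cong: weak_congs)

lemma four_check_3:
  "search (check_four (entry reflections 3) (1, [[], [3], [4], [5], [3,4], [3,5], [4,3]])
      (2, [[], [3], [4], [3,4], [4,3], [5,4]])) (entry reflections 3) [1,2,3] []"
  by (simp only: check_simps reflections_def rot_simps search_eval basic_eval W_evals stab_eval
    cong: weak_congs)

lemma four_check_4:
  "search (check_four (entry reflections 4) (1, []) (1, [])) (entry reflections 4) [1,2,3] []"
  by (simp only: check_simps reflections_def rot_simps search_eval basic_eval W_evals stab_eval
    cong: weak_congs)

section \<open>Classification of the C-strings\<close>

definition common_rels :: "(nat list \<times> nat list) list" where
  "common_rels = [([1,1], []), ([2,2], []), ([3,3], []), ([4,4], []), ([5,5], []),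
     ([1,3], [3,1]), ([1,4], [4,1]), ([1,5], [5,1]), ([2,4], [4,2]), ([2,5], [5,2]), ([3,5], [5,3]),
     ([1,2,1,2,1,2,1,2], []), ([2,3,2,3,2,3,2,3,2,3,2,3,2,3,2,3,2,3,2,3], []), ([3,4,3,4,3,4], [])]"

definition last_rel :: "nat \<Rightarrow> nat list" where
  "last_rel j = (if j = 5 then [4,5,4,5,4,5,4,5] else [4,5,4,5,4,5])"

definition nonrels :: "(nat list \<times> nat list) list" where
  "nonrels = [([1], []), ([5], []), ([2,3,2,3], []), ([2,3,2,3,2,3,2,3,2,3], []),
     ([5], [2,3,2,3,2,3,2,3,2,3]), ([4,5,4,5], []), ([5], word_a), ([5], word_b), ([1], word_c)]"

text \<open>A condition on permutations alone, so that it can be transported by conjugation. The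
  value \<open>j\<close> is 5 for the symbol \<open>[4,10,3,4]\<close> and 6 for
  \<open>[4,10,3,3]\<close>.\<close>

definition good :: "nat \<Rightarrow> (nat \<Rightarrow> nat \<Rightarrow> nat) \<Rightarrow> bool" where
  "good j s \<longleftrightarrow> (\<forall>i\<in>{1..5}. s i \<in> M) \<and> wfun s (last_rel j) = id \<and>
     (\<forall>(w, v)\<in>set common_rels. wfun s w = wfun s v) \<and>
     (\<forall>(w, v)\<in>set nonrels. wfun s w \<noteq> wfun s v)"

lemma conj_wfun:
  assumes "f \<circ> g = id" "g \<circ> f = id"
  shows "wfun (\<lambda>i. f \<circ> s i \<circ> g) w = f \<circ> wfun s w \<circ> g"
proof (induction w)
  case Nil
  then show ?case using assms by auto
next
  case (Cons i w)
  have gf: "g (f x) = x" for x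
    using fun_cong[OF assms(2), of x] by simp
  show ?case
    unfolding wfun.simps Cons by (rule ext) (simp add: gf)
qed

lemma good_conj:
  assumes s: "good j s" and fg: "f \<in> M" "g \<in> M" "f \<circ> g = id" "g \<circ> f = id"
  shows "good j (\<lambda>i. f \<circ> s i \<circ> g)"
proof -
  have gf: "g (f x) = x" for x
    using fun_cong[OF fg(4), of x] by simp
  have eq: "f \<circ> A \<circ> g = f \<circ> B \<circ> g \<longleftrightarrow> A = B" for A B
  proof
    assume "f \<circ> A \<circ> g = f \<circ> B \<circ> g"
    then have "g ((f \<circ> A \<circ> g) (f x)) = g ((f \<circ> B \<circ> g) (f x))" for x
      by simp
    then show "A = B"
      by (intro ext) (simp add: gf)
  qed simp
  have "wfun (\<lambda>i. f \<circ> s i \<circ> g) (last_rel j) = id"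
    using s unfolding conj_wfun[OF fg(3,4)] good_def by (simp add: fg(3))
  then show ?thesis
    using s fg unfolding good_def conj_wfun[OF fg(3,4)] eq by (blast intro: M_comp)
qed

lemma to_points:
  assumes "length xs = 5" "distinct xs" "set xs \<subseteq> {1..24}" "length ys = 5" "distinct ys" "set ys \<subseteq>
    {1..24}"
  obtains f where "f \<in> M" "map f xs = ys"
proof -
  obtain d where d: "d \<in> M" "map d xs = base"
    using to_base[OF assms(1-3)] .
  obtain e where e: "e \<in> M" "map e ys = base"
    using to_base[OF assms(4-6)] .
  obtain e' where e': "e' \<in> M" "e' \<circ> e = id"
    using M_inverse[OF e(1)] by metis
  have "map (e' \<circ> d) xs = map e' (map e ys)"
    using d(2) e(2) by (simp flip: map_map)
  also have "\<dots> = ys"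
    by (simp add: e'(2))
  finally show ?thesis
    using that M_comp[OF e'(1) d(1)] by blast
qed

lemma rot_M: "length rot = 24" "act rot = gf 2 \<circ> gf 3" "act rot \<in> M"
  using gf_M[of 2] gf_M[of 3] gens_length[OF gens_in, of 2] gens_length[OF gens_in, of 3]
  by (auto simp: rot_def act_pcomp M_comp)

lemma run_M:
  assumes "\<And>i. i \<in> set w \<Longrightarrow> act (entry ts i) \<in> M"
  shows "run ts w x \<in> {1..24} \<longleftrightarrow> x \<in> {1..24}"
  using run_wfun[of w ts "\<lambda>i. act (entry ts i)" x] M_in[OF wfun_M[of w "\<lambda>i. act (entry ts i)"]]
    assms by simp

text \<open>The length of the cycle of \<open>x\<close> divides 10 but not 2, so it is 5 or 10.
  Concretely, if the third power fixed \<open>x\<close>, the tenth would give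
  \<open>a x = x\<close>; if the fourth did, it would give \<open>a (a x) = x\<close>.\<close>

lemma distinct_orbit:
  assumes a: "a \<in> M" and a10: "(a ^^ 10) = id" and x: "a (a x) \<noteq> x"
  shows "distinct [x, a x, a (a x), a (a (a x)), a (a (a (a x)))]"
proof -
  have t: "a (a (a (a (a (a (a (a (a (a z))))))))) = z" for z
    using fun_cong[OF a10, of z] by (simp add: eval_nat_numeral)
  have "a x \<noteq> x"
    using x by metis
  moreover have "a (a (a x)) \<noteq> x"
  proof
    assume h: "a (a (a x)) = x"
    show False using t[of x] \<open>a x \<noteq> x\<close> unfolding h by simp
  qed
  moreover have "a (a (a (a x))) \<noteq> x"
  proof
    assume h: "a (a (a (a x))) = x"
    show False using t[of x] x unfolding h by simp
  qed
  ultimately show ?thesis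
    using x by (simp add: M_inj[OF a])
qed

lemma powers_letters: "w \<in> set powers \<Longrightarrow> set w \<subseteq> {1}"
proof -
  have "list_all (\<lambda>w. set w \<subseteq> {1}) powers"
    by (simp add: powers_def)
  then show "w \<in> set powers \<Longrightarrow> set w \<subseteq> {1}"
    by (auto simp: list_all_iff)
qed

lemma powers_run:
  assumes "w \<in> set powers" "act t \<in> M"
  shows "run [t] w 23 \<in> {1..24}"
proof (subst run_M)
  show "act (entry [t] i) \<in> M" if "i \<in> set w" for i
    using powers_letters[OF assms(1)] assms(2) that by (auto simp: entry_def)
qed simp

lemma conj_to_rot:
  assumes a: "a \<in> M" and a10: "(a ^^ 10) = id" and a2: "a ^^ 2 \<noteq> id" and a5: "a ^^ 5 \<noteq> id"
  obtains f where "f \<in> M" "f \<circ> a = act rot \<circ> f"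
proof -
  obtain x where x: "a (a x) \<noteq> x"
    using a2 by (auto simp: fun_eq_iff eval_nat_numeral)
  then have x24: "x \<in> {1..24}"
    using M_out[OF a] by metis
  \<comment> \<open>The targets begin the 10-cycle of \<open>rot\<close> through 23. The conjugate
    \<open>b\<close> then agrees with \<open>rot\<close> at four points, and \<open>b 4\<close> is
    the value left open.\<close>
  obtain f where f: "f \<in> M" "map f [x, a x, a (a x), a (a (a x)), a (a (a (a x)))] = [23, 8, 17, 13,
    4]"
    by (rule to_points[of "[x, a x, a (a x), a (a (a x)), a (a (a (a x)))]" "[23, 8, 17, 13, 4]"])
      (use distinct_orbit[OF a a10 x] x24 M_in[OF a] in auto)
  obtain g where g: "g \<in> M" "g \<circ> f = id" "f \<circ> g = id"
    using M_inverse[OF f(1)] .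
  define b where "b = f \<circ> a \<circ> g"
  have gf: "g (f z) = z" for z
    using fun_cong[OF g(2), of z] by simp
  have b: "b \<in> M" "b (f z) = f (a z)" for z
    using f g a by (auto simp: b_def gf intro!: M_comp)
  have b_vals: "b 23 = 8" "b 8 = 17" "b 17 = 13" "b 13 = 4"
    using f(2) b(2)[of x] b(2)[of "a x"] b(2)[of "a (a x)"] b(2)[of "a (a (a x))"] by auto
  have b_ne: "b 4 \<notin> {8, 17, 13, 4}"
    using M_inj[OF b(1), of 4 23] M_inj[OF b(1), of 4 8] M_inj[OF b(1), of 4 17] M_inj[OF b(1), of 4
      13]
    by (simp add: b_vals)
  have ext: "all_ext check_rot [(23,8), (8,17), (17,13), (13,4), (4, b 4)]"
    using rot_check b_ne M_in[OF b(1), of 4] by (auto simp: list_all_iff)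
  have "u \<in> {1..24} \<and> b u = v" if "(u, v) \<in> set [(23,8), (8,17), (17,13), (13,4), (4, b 4)]" for u v
    using that b_vals by auto
  then obtain p where p: "length p = 24" "act p = b" "check_rot p"
    using candidates[OF b(1) _ ext] by blast
  have bw: "wfun (\<lambda>_. b) w = f \<circ> wfun (\<lambda>_. a) w \<circ> g" for w
    unfolding b_def by (rule conj_wfun[OF g(3,2)])
  have aw: "wfun (\<lambda>_. a) w = a ^^ length w" for w :: "nat list"
    by (induction w) auto
  have sat: "sat [p] w [] \<longleftrightarrow> a ^^ length w = id" if "set w \<subseteq> {1}" for w
  proof -
    have "sat [p] w [] \<longleftrightarrow> wfun (\<lambda>_. b) w = wfun (\<lambda>_. b) []"
      by (rule sat_iff) (use that p M_out[OF b(1)] in \<open>auto simp: entry_def\<close>)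
    also have "\<dots> \<longleftrightarrow> a ^^ length w = id"
    proof
      assume "wfun (\<lambda>_. b) w = wfun (\<lambda>_. b) []"
      then have "f ((a ^^ length w) z) = f z" for z
        unfolding bw aw wfun.simps by (auto simp: fun_eq_iff gf dest!: spec[of _ "f z"])
      then show "a ^^ length w = id"
        by (simp add: M_inj[OF f(1)] fun_eq_iff)
    next
      assume "a ^^ length w = id"
      then show "wfun (\<lambda>_. b) w = wfun (\<lambda>_. b) []"
        unfolding bw aw wfun.simps by (simp add: g)
    qed
    finally show ?thesis .
  qed
  have "order_10 p"
    unfolding order_10_def using a10 a2 a5 by (simp add: sat eval_nat_numeral del: funpow.simps)
  then have "conj_rot p"
    using p(3) by (simp add: check_rot_def)
  then obtain h where ok: "sources_ok (map (\<lambda>w. (run [p] w 23, run [rot] w 23)) powers)"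
      "targets_ok (map (\<lambda>w. (run [p] w 23, run [rot] w 23)) powers)"
    and h: "h \<in> set (candidates (map (\<lambda>w. (run [p] w 23, run [rot] w 23)) powers))" "pcomp h p =
      pcomp rot h"
    unfolding conj_rot_def Let_def list_ex_iff by blast
  have "set (map (\<lambda>w. (run [p] w 23, run [rot] w 23)) powers) \<subseteq> {1..24} \<times> {1..24}"
    using powers_run[of _ p] powers_run[of _ rot] p(2) b(1) rot_M(3)
    by (auto simp del: atLeastAtMost_iff)
  note h' = candidates_M[OF ok h(1) this]
  have "act h \<circ> b = act rot \<circ> act h"
    using h(2) h' p(1,2) rot_M(1) by (metis act_pcomp)
  then have "act h (b z) = act rot (act h z)" for z
    by (simp add: fun_eq_iff)
  then have "(act h \<circ> f) \<circ> a = act rot \<circ> (act h \<circ> f)"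
    by (auto simp: fun_eq_iff simp flip: b(2))
  then show ?thesis
    using that M_comp[OF h'(2) f(1)] by blast
qed


lemma five_class:
  assumes f: "f \<in> M" "f \<circ> act rot = act rot \<circ> f" "f \<circ> f = id" "f \<noteq> id" "f \<noteq> act rot ^^ 5"
  shows "f = gf 5 \<or> f = gf 6"
proof -
  let ?ps = "map (\<lambda>w. (run [rot] w 23, run [rot] w (f 23))) powers"
  have e: "entry [rot] i = rot" if "i \<in> {1}" for i
    using that by (simp add: entry_def)
  have ext: "all_ext check_five ?ps"
    using five_check M_in[OF f(1), of 23] by (simp add: list_all_iff)
  have "u \<in> {1..24} \<and> f u = v" if uv: "(u, v) \<in> set ?ps" for u v
  proof -
    obtain w where w: "w \<in> set powers" "u = run [rot] w 23" "v = run [rot] w (f 23)"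
      using uv by auto
    have i: "entry [rot] i = rot" if "i \<in> set w" for i
      using e powers_letters[OF w(1)] that by blast
    have "u \<in> {1..24}"
      unfolding w(2) by (subst run_M) (simp_all add: i rot_M(3) del: atLeastAtMost_iff, simp)
    moreover have "f u = v"
      unfolding w(2,3) by (rule run_commute) (use fun_cong[OF f(2)] i in simp)
    ultimately show ?thesis ..
  qed
  then obtain p where p: "length p = 24" "act p = f" "check_five p"
    using candidates[OF f(1) _ ext] by blast
  let ?s = "\<lambda>i. if i = 1 then f else act rot"
  have sat: "sat [p, rot] w v \<longleftrightarrow> wfun ?s w = wfun ?s v" if "set w \<subseteq> {1,2}" "set v \<subseteq> {1,2}" for w v
    by (rule sat_iff) (use that p rot_M(3) M_out[OF f(1)] M_out[OF rot_M(3)] in \<open>auto simp: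
      entry_def\<close>)
  have sat1: "sat [p] w v \<longleftrightarrow> wfun (\<lambda>_. f) w = wfun (\<lambda>_. f) v" if "set w \<subseteq> {1}" "set v \<subseteq> {1}" for w v
    by (rule sat_iff) (use that p M_out[OF f(1)] in \<open>auto simp: entry_def\<close>)
  have "sat [p, rot] [1,2] [2,1]" "sat [p] [1,1] []" "\<not> sat [p] [1] []" "\<not> sat [p, rot] [1]
    [2,2,2,2,2]"
    using f(2-5) by (simp_all add: sat sat1 eval_nat_numeral)
  then have "p = entry gens 5 \<or> p = entry gens 6"
    using p(3) by (simp add: check_five_def)
  then show ?thesis
    using p(2) by auto
qed

text \<open>The conjugator \<open>c\<close> is a power of \<open>rot\<close> and so commutes with
  the whole centraliser of \<open>rot\<close>. In this way it leaves the fifth generator in place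
  while it moves the second.\<close>

lemma two_class:
  assumes f: "f \<in> M" "f \<circ> f = id" "f \<circ> act rot \<circ> f \<circ> act rot = id" and rot10: "act rot ^^ 10 = id"
  obtains r c where "r \<in> set reflections" "c \<in> M" "c \<circ> f = act r \<circ> c"
    "\<And>h. h \<circ> act rot = act rot \<circ> h \<Longrightarrow> c \<circ> h = h \<circ> c"
proof -
  let ?a = "act rot"
  let ?ps = "map2 (\<lambda>w v. (run [rot] w 23, run [rot] v (f 23))) powers ([] # rev (tl powers))"
  have a10: "?a (?a (?a (?a (?a (?a (?a (?a (?a (?a z))))))))) = z" for z
    using fun_cong[OF rot10, of z] by (simp add: eval_nat_numeral)
  have "f (?a (f (?a z))) = z" "f (f z) = z" for z
    using fun_cong[OF f(3), of z] fun_cong[OF f(2), of z] by simp_all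
  then have "?a (f (?a z)) = f z" for z
    by metis
  \<comment> \<open>The inverse of \<open>rot\<close> is written as its ninth power.\<close>
  then have fa: "f (?a z) = ?a (?a (?a (?a (?a (?a (?a (?a (?a (f z)))))))))" for z
    by (metis a10)
  have ext: "all_ext check_two ?ps"
    using two_check M_in[OF f(1), of 23] by (simp add: list_all_iff)
  have e: "entry [rot] (Suc 0) = rot"
    by (simp add: entry_def)
  have "list_all (\<lambda>(u, v). f u = v) ?ps"
    by (simp add: powers_def e fa a10)
  moreover have "u \<in> {1..24}" if uv: "(u, v) \<in> set ?ps" for u v
  proof -
    obtain w where w: "w \<in> set powers" "u = run [rot] w 23"
      using uv by (auto dest: set_zip_leftD)
    then have "entry [rot] i = rot" if "i \<in> set w" for i
      using e powers_letters[OF w(1)] that by auto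
    then show ?thesis
      unfolding w(2) by (subst run_M) (simp_all add: rot_M(3) del: atLeastAtMost_iff, simp)
  qed
  ultimately have "u \<in> {1..24} \<and> f u = v" if "(u, v) \<in> set ?ps" for u v
    using that by (auto simp: list_all_iff)
  then obtain p where p: "length p = 24" "act p = f" "check_two p"
    using candidates[OF f(1) _ ext] by blast
  let ?s = "\<lambda>i. if i = 1 then f else ?a"
  have sat: "sat [p, rot] w v \<longleftrightarrow> wfun ?s w = wfun ?s v" if "set w \<subseteq> {1,2}" "set v \<subseteq> {1,2}" for w v
    by (rule sat_iff) (use that p rot_M(3) M_out[OF f(1)] M_out[OF rot_M(3)] in \<open>auto simp:
      entry_def\<close>)
  have "sat [p, rot] [1,1] []" "sat [p, rot] [1,2,1,2] []"
    using f(2,3) by (simp_all add: sat o_assoc)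
  then obtain r w where r: "r \<in> set reflections" and w: "w \<in> set [[], [2], [2,2], [2,2,2], [2,2,2,2]]"
    and rc: "sat [p, rot, r] (w @ [1]) (3 # w)"
    using p(3) unfolding check_two_def list_ex_iff by blast
  have w2: "set w \<subseteq> {2}"
    using w by auto
  let ?t = "\<lambda>i. if i = 1 then f else if i = 2 then ?a else act r"
  have "length r = 24"
    using r gens_length[OF gens_in, of 2] gens_length[OF gens_in, of 3] by (auto simp:
      reflections_def)
  then have "x \<notin> {1..24} \<Longrightarrow> act r x = x" for x
    unfolding act_def by presburger
  then have "wfun ?t (w @ [1]) = wfun ?t (3 # w)"
    using rc by (subst (asm) sat_iff[where s = ?t])
      (use w2 p M_out[OF f(1)] M_out[OF rot_M(3)] in \<open>auto simp: entry_def\<close>)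
  moreover have "wfun ?t w \<in> M"
    by (rule wfun_M) (use w2 f rot_M in auto)
  moreover have "wfun ?t w \<circ> h = h \<circ> wfun ?t w" if h: "h \<circ> ?a = ?a \<circ> h" for h
    using w2
  proof (induction w)
    case (Cons i w)
    have i: "?t i = ?a"
      using Cons.prems by simp
    have IH: "wfun ?t w \<circ> h = h \<circ> wfun ?t w"
      by (rule Cons.IH) (use Cons.prems in simp)
    show ?case
      unfolding wfun.simps i o_assoc[symmetric] IH by (simp only: o_assoc h)
  qed simp
  ultimately show ?thesis
    using that[OF r, of "wfun ?t w"] by (simp add: wfun_append)
qed


lemma goodD:
  assumes "good j s"
  shows "i \<in> {1..5} \<Longrightarrow> s i \<in> M" "(w, v) \<in> set common_rels \<Longrightarrow> wfun s w = wfun s v"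
    "wfun s (last_rel j) = id" "(w, v) \<in> set nonrels \<Longrightarrow> wfun s w \<noteq> wfun s v"
  using assms unfolding good_def by auto

lemma good_sat:
  assumes "good j s" "\<And>i. i \<in> set w \<union> set v \<Longrightarrow> i \<in> {1..5} \<and> act (entry ts i) = s i"
  shows "sat ts w v \<longleftrightarrow> wfun s w = wfun s v"
  using assms(2) M_out[OF goodD(1)[OF assms(1)]] by (intro sat_iff) blast+

definition tag :: "nat \<Rightarrow> nat \<Rightarrow> nat" where
  "tag j i = (if i = 5 then j else i)"

text \<open>\<open>k\<close> tells which of the two involutions the fifth generator is, and
  \<open>j\<close> which symbol is given; the checks cover all four combinations. The fourth
  generator is found as the table \<open>p\<close>, and then the first as \<open>q\<close>.\<close>

lemma finish:
  assumes srch: "search (check_four r s5 s6) r xs []" "set xs \<subseteq> {1..24}"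
    and starts: "\<And>x ws. (x, ws) \<in> {s5, s6} \<Longrightarrow> x \<in> {1..24} \<and> list_all (\<lambda>w. set w \<subseteq> {3,4,5}) ws"
    and r: "length r = 24" "act r = s 2" and s: "good j s" "s 3 = act r \<circ> act rot"
    and k: "s 5 = gf k" "k \<in> {5,6}" and j: "j \<in> {5,6}"
  obtains c where "c \<in> M" "\<And>i. i \<in> {1..5} \<Longrightarrow> c \<circ> s i = gf (tag j i) \<circ> c"
proof -
  note sM = goodD(1)[OF s(1)] and rel = goodD(2)[OF s(1)] and nrel = goodD(4)[OF s(1)]
  define t3 where "t3 = pcomp r rot"
  have t3: "act t3 = s 3"
    using r(1) rot_M(1) s(2) by (simp add: t3_def act_pcomp)
  have four: "s 4 \<circ> s 4 = id" "s 4 \<circ> act r = act r \<circ> s 4"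
    using rel[of "[4,4]" "[]"] rel[of "[2,4]" "[4,2]"] by (simp_all add: common_rels_def r(2))
  obtain p where p: "length p = 24" "act p = s 4" "check_four r s5 s6 p"
    using srch(2) search[OF sM[of 4] four _ srch(1)] sM[of 2] r(2) by auto
  have sat4: "sat [pts, r, t3, p, pts] w v \<longleftrightarrow> wfun s w = wfun s v" if "set w \<subseteq> {2,3,4}" "set v \<subseteq>
    {2,3,4}" for w v
    by (rule good_sat[OF s(1)]) (use that p(2) t3 r(2) in \<open>auto simp: entry_def\<close>)
  have "sat [pts, r, t3, p, pts] w v"
    if "(w, v) \<in> set common_rels" "set w \<subseteq> {2,3,4}" "set v \<subseteq> {2,3,4}" for w v
    using that rel sat4 by blast
  then have sat_e: "sat [pts, r, t3, p, pts] [4,4] []" "sat [pts, r, t3, p, pts] [2,4] [4,2]"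
    "sat [pts, r, t3, p, pts] [3,4,3,4,3,4] []"
    by (simp_all add: common_rels_def)
  then have "list_all (\<lambda>(k, x, ws). list_all (check_last r t3 p k x ws) [5,6]) [(5, s5), (6, s6)]"
    by (intro p(3)[unfolded check_four_def Let_def t3_def[symmetric], THEN mp] conjI sat_e)
  moreover define x ws where "x = fst (if k = 5 then s5 else s6)" and "ws = snd (if k = 5 then s5
    else s6)"
  ultimately have last: "check_last r t3 p k x ws j"
    using k(2) j by (auto split: prod.splits)
  let ?ts = "[pts, r, t3, p, entry gens k]"
  have ts: "i \<in> {1..5} \<and> act (entry ?ts i) = s i" if "i \<in> {2,3,4,5}" for i
    using that r(2) t3 p(2) k(1) by (auto simp: entry_def)
  have satl: "sat ?ts w v \<longleftrightarrow> wfun s w = wfun s v" if "set w \<subseteq> {2,3,4,5}" "set v \<subseteq> {2,3,4,5}" for w v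
    by (rule good_sat[OF s(1)], rule ts) (use that in blast)
  have sat_a: "sat ?ts (if j = 5 then [4,5,4,5,4,5,4,5] else [4,5,4,5,4,5]) []"
    using goodD(3)[OF s(1)] by (subst satl) (auto simp: last_rel_def)
  have "\<not> sat ?ts w v"
    if "(w, v) \<in> set nonrels" "set w \<subseteq> {2,3,4,5}" "set v \<subseteq> {2,3,4,5}" for w v
    using that nrel satl by blast
  then have sat_b: "\<not> sat ?ts [4,5,4,5] []" "\<not> sat ?ts [5] word_a" "\<not> sat ?ts [5] word_b"
    by (simp_all add: nonrels_def word_a_def word_b_def)
  have one: "list_all (\<lambda>y. all_ext (check_one r t3 p (entry gens k) j)
      (map (\<lambda>w. (run ?ts w x, run ?ts w y)) ws)) pts"
    by (rule last[unfolded check_last_def Let_def, THEN mp]) (intro conjI sat_a sat_b)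
  have x: "x \<in> {1..24}" and ws: "\<And>w. w \<in> set ws \<Longrightarrow> set w \<subseteq> {3,4,5}"
    using starts[of x ws] by (auto simp: x_def ws_def list_all_iff split: if_splits)
  have ext: "all_ext (check_one r t3 p (entry gens k) j) (map (\<lambda>w. (run ?ts w x, run ?ts w (s 1 x)))
    ws)"
    using one M_in[OF sM[of 1], of x] x by (simp add: list_all_iff)
  have c1: "s 1 (s i z) = s i (s 1 z)" if "i \<in> {3,4,5}" for i z
  proof -
    have "wfun s [1,i] = wfun s [i,1]"
      using that by (intro rel) (auto simp: common_rels_def)
    then show ?thesis
      by (simp add: fun_eq_iff)
  qed
  have s1: "s 1 \<in> M"
    by (rule sM) simp
  have gr: "u \<in> {1..24} \<and> s 1 u = v" if uv: "(u, v) \<in> set (map (\<lambda>w. (run ?ts w x, run ?ts w (s 1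
    x))) ws)" for u v
  proof -
    obtain w where w: "w \<in> set ws" "u = run ?ts w x" "v = run ?ts w (s 1 x)"
      using uv by auto
    have i: "act (entry ?ts i) = s i \<and> i \<in> {3,4,5}" if "i \<in> set w" for i
      using ws[OF w(1)] that ts[of i] by blast
    have "u \<in> {1..24}"
      unfolding w(2)
    proof (subst run_M)
      show "act (entry ?ts i) \<in> M" if "i \<in> set w" for i
        using i[OF that] sM[of i] by auto
    qed (rule x)
    moreover have "s 1 u = v"
      unfolding w(2,3) by (rule run_commute) (use i c1 in simp)
    ultimately show ?thesis ..
  qed
  obtain q where q: "length q = 24" "act q = s 1" "check_one r t3 p (entry gens k) j q"
    by (rule candidates[OF s1 gr ext])
  let ?us = "[q, r, t3, p, entry gens k]"
  have us: "act (entry ?us i) = s i \<and> length (entry ?us i) = 24" if "i \<in> {1..5}" for i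
  proof -
    have "i \<in> {1,2,3,4,5}" using that by auto
    then show ?thesis
      using r t3 p q k gens_length[OF gens_in, of k] rot_M(1) by (auto simp: entry_def t3_def)
  qed
  have satu: "sat ?us w v \<longleftrightarrow> wfun s w = wfun s v" if "set w \<union> set v \<subseteq> {1..5}" for w v
    by (rule good_sat[OF s(1)]) (use that us in blast)
  have "sat ?us w v" if "(w, v) \<in> set common_rels" "set w \<union> set v \<subseteq> {1..5}" for w v
    using that rel satu by blast
  then have sat_c: "sat ?us [1,1] []" "sat ?us [1,3] [3,1]" "sat ?us [1,4] [4,1]" "sat ?us [1,5]
    [5,1]"
      "sat ?us [1,2,1,2,1,2,1,2] []"
    by (simp_all add: common_rels_def)
  have "\<not> sat ?us w v" if "(w, v) \<in> set nonrels" "set w \<union> set v \<subseteq> {1..5}" for w v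
    using that nrel satu by blast
  then have sat_d: "\<not> sat ?us [1] []" "\<not> sat ?us [1] word_c"
    by (simp_all add: nonrels_def word_c_def)
  have "list_ex (\<lambda>c. list_all (\<lambda>(i, k). pcomp c (entry ?us i) = pcomp (entry gens k) c)
      [(1,1), (2,2), (3,3), (4,4), (5,j)]) [pts, entry gens 5, entry gens 6, pcomp (entry gens 5)
        (entry gens 6)]"
    by (rule q(3)[unfolded check_one_def Let_def, THEN mp]) (intro conjI sat_c sat_d)
  then obtain c where c: "c \<in> set [pts, entry gens 5, entry gens 6, pcomp (entry gens 5) (entry gens
    6)]"
      "\<And>i k. (i, k) \<in> set [(1,1), (2,2), (3,3), (4,4), (5,j)] \<Longrightarrow> pcomp c (entry ?us i) = pcomp (entry
        gens k) c"
    unfolding list_ex_iff list_all_iff by blast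
  have g: "length (entry gens i) = 24" "gf i \<in> M" if "i \<in> {1..6}" for i
    using gens_length[OF gens_in] gf_M that by auto
  have cM: "length c = 24" "act c \<in> M"
    using c(1) g[of 5] g[of 6] by (auto simp: act_pcomp M_id M_comp)
  show ?thesis
  proof (rule that[OF cM(2)])
    fix i :: nat assume i: "i \<in> {1..5}"
    then have "i \<in> {1,2,3,4,5}" by auto
    then have "pcomp c (entry ?us i) = pcomp (entry gens (tag j i)) c"
      by (intro c(2)) (auto simp: tag_def)
    moreover have "tag j i \<in> {1..6}"
      using i j by (auto simp: tag_def)
    ultimately show "act c \<circ> s i = gf (tag j i) \<circ> act c"
      using us[OF i] cM(1) g by (metis act_pcomp)
  qed
qed


lemma comp_cancel_left: "g \<circ> f = id \<Longrightarrow> f \<circ> a = f \<circ> b \<Longrightarrow> a = b"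
  by (metis comp_assoc id_comp)

lemma reflections_finish:
  assumes ref: "r \<in> set reflections" and r: "act r = s 2"
    and s: "good j s" "s 3 = act r \<circ> act rot" and k: "s 5 = gf k" "k \<in> {5,6}" and j: "j \<in> {5,6}"
  obtains c where "c \<in> M" "\<And>i. i \<in> {1..5} \<Longrightarrow> c \<circ> s i = gf (tag j i) \<circ> c"
proof -
  have len: "length r = 24"
    using ref gens_length[OF gens_in, of 2] gens_length[OF gens_in, of 3] by (auto simp:
      reflections_def)
  note fin = finish[OF _ _ _ len r s k j]
  have e: "entry reflections 3 = reflections ! 2" "entry reflections 4 = reflections ! 3"
    by (simp_all add: entry_def)
  consider "r = entry gens 2" | "r = entry gens 3" | "r = entry reflections 3" | "r = entry
    reflections 4"
    using ref unfolding e by (auto simp: reflections_def)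
  then show ?thesis
  proof cases
    case 1
    show ?thesis by (rule fin[OF four_check_1[folded 1]]) (auto intro: that)
  next
    case 2
    show ?thesis by (rule fin[OF four_check_2[folded 2]]) (auto intro: that)
  next
    case 3
    show ?thesis by (rule fin[OF four_check_3[folded 3]]) (auto intro: that)
  next
    case 4
    show ?thesis by (rule fin[OF four_check_4[folded 4]]) (auto intro: that)
  qed
qed

text \<open>Three conjugations: \<open>f\<close> turns the product of the second and third
  generators into \<open>rot\<close>, \<open>c\<close> brings the second into
  \<open>reflections\<close> without disturbing \<open>rot\<close> and the fifth, and
  \<open>e\<close> completes the match with the standard string.\<close>

theorem classification:
  assumes s: "good j s" and j: "j \<in> {5,6}"
  obtains c where "c \<in> M" "\<And>i. i \<in> {1..5} \<Longrightarrow> c \<circ> s i = gf (tag j i) \<circ> c"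
proof -
  note sM = goodD(1)[OF s] and rel = goodD(2)[OF s] and nrel = goodD(4)[OF s]
  define a where "a = s 2 \<circ> s 3"
  have aM: "a \<in> M"
    unfolding a_def by (intro M_comp sM) auto
  have "a ^^ 10 = id" "a ^^ 2 \<noteq> id" "a ^^ 5 \<noteq> id"
    using rel[of "[2,3,2,3,2,3,2,3,2,3,2,3,2,3,2,3,2,3,2,3]" "[]"] nrel[of "[2,3,2,3]" "[]"]
      nrel[of "[2,3,2,3,2,3,2,3,2,3]" "[]"]
    by (simp_all add: common_rels_def nonrels_def a_def eval_nat_numeral o_assoc)
  then obtain f where f: "f \<in> M" "f \<circ> a = act rot \<circ> f"
    using conj_to_rot[OF aM] by metis
  obtain g where g: "g \<in> M" "g \<circ> f = id" "f \<circ> g = id"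
    using M_inverse[OF f(1)] .
  define u where "u i = f \<circ> s i \<circ> g" for i
  have u: "good j u"
    using good_conj[OF s f(1) g(1,3,2)] unfolding u_def[abs_def] .
  note uM = goodD(1)[OF u] and urel = goodD(2)[OF u] and unrel = goodD(4)[OF u]
  have u23: "u 2 \<circ> u 3 = act rot"
  proof -
    have "u 2 \<circ> u 3 = f \<circ> s 2 \<circ> (g \<circ> f) \<circ> s 3 \<circ> g"
      unfolding u_def by (simp only: o_assoc)
    also have "\<dots> = (f \<circ> a) \<circ> g"
      unfolding g(2) comp_id a_def by (simp only: o_assoc)
    also have "\<dots> = act rot \<circ> (f \<circ> g)"
      unfolding f(2) by (simp only: o_assoc)
    finally show ?thesis
      unfolding g(3) comp_id .
  qed
  have inv: "u i \<circ> u i = id" if "i \<in> {1,2,3,4,5}" for i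
  proof -
    have "wfun u [i,i] = wfun u []"
      using that by (intro urel) (auto simp: common_rels_def)
    then show ?thesis by simp
  qed
  have comm: "u 2 \<circ> u 5 = u 5 \<circ> u 2" "u 3 \<circ> u 5 = u 5 \<circ> u 3"
    using urel[of "[2,5]" "[5,2]"] urel[of "[3,5]" "[5,3]"] by (simp_all add: common_rels_def)
  have c5: "u 5 \<circ> act rot = act rot \<circ> u 5"
    unfolding u23[symmetric] using comm by (metis comp_assoc)
  have rot5: "act rot ^^ 5 = wfun u [2,3,2,3,2,3,2,3,2,3]" and rot10: "act rot ^^ 10 = wfun u
    [2,3,2,3,2,3,2,3,2,3,2,3,2,3,2,3,2,3,2,3]"
    unfolding u23[symmetric] by (simp_all add: eval_nat_numeral o_assoc)
  have "u 5 \<noteq> id" "u 5 \<noteq> act rot ^^ 5"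
    using unrel[of "[5]" "[]"] unrel[of "[5]" "[2,3,2,3,2,3,2,3,2,3]"] unfolding rot5
    by (simp_all add: nonrels_def)
  then have "u 5 = gf 5 \<or> u 5 = gf 6"
    using five_class[OF uM[of 5] c5 inv[of 5]] by auto
  then obtain k where k: "u 5 = gf k" "k \<in> {5,6}"
    by auto
  have "u 2 \<circ> act rot = (u 2 \<circ> u 2) \<circ> u 3"
    unfolding u23[symmetric] by (simp only: o_assoc)
  then have u3: "u 3 = u 2 \<circ> act rot"
    using inv[of 2] by simp
  have "u 2 \<circ> act rot \<circ> u 2 \<circ> act rot = u 3 \<circ> u 3"
    unfolding u3 by (simp only: o_assoc)
  also have "\<dots> = id"
    using inv[of 3] by simp
  finally have ref: "u 2 \<circ> act rot \<circ> u 2 \<circ> act rot = id" .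
  have "act rot ^^ 10 = id"
    unfolding rot10 using urel[of "[2,3,2,3,2,3,2,3,2,3,2,3,2,3,2,3,2,3,2,3]" "[]"]
    by (simp add: common_rels_def)
  then obtain r c where r: "r \<in> set reflections" and c: "c \<in> M" "c \<circ> u 2 = act r \<circ> c"
    and cc: "\<And>h. h \<circ> act rot = act rot \<circ> h \<Longrightarrow> c \<circ> h = h \<circ> c"
    using two_class[OF uM[of 2] inv[of 2] ref] by auto
  obtain d where d: "d \<in> M" "d \<circ> c = id" "c \<circ> d = id"
    using M_inverse[OF c(1)] .
  define v where "v i = c \<circ> u i \<circ> d" for i
  have v: "good j v"
    using good_conj[OF u c(1) d(1,3,2)] unfolding v_def[abs_def] .
  have v2: "act r = v 2"
    unfolding v_def c(2) comp_assoc d(3) by simp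
  have v5: "v 5 = gf k"
    unfolding v_def cc[OF c5] comp_assoc d(3) by (simp add: k(1))
  have "v 3 = c \<circ> u 2 \<circ> act rot \<circ> d"
    unfolding v_def u3 by (simp only: o_assoc)
  also have "\<dots> = act r \<circ> (c \<circ> act rot) \<circ> d"
    unfolding c(2) by (simp only: o_assoc)
  also have "\<dots> = act r \<circ> act rot \<circ> (c \<circ> d)"
    unfolding cc[OF refl] by (simp only: o_assoc)
  finally have v3: "v 3 = act r \<circ> act rot"
    unfolding d(3) comp_id .
  obtain e where e: "e \<in> M" "\<And>i. i \<in> {1..5} \<Longrightarrow> e \<circ> v i = gf (tag j i) \<circ> e"
    by (rule reflections_finish[OF r v2 v v3 v5 k(2) j], blast)
  show ?thesis
  proof (rule that)
    show "e \<circ> c \<circ> f \<in> M"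
      by (intro M_comp e c f)
    fix i :: nat assume i: "i \<in> {1..5}"
    have "e \<circ> v i \<circ> c \<circ> f = e \<circ> c \<circ> f \<circ> s i \<circ> (g \<circ> (d \<circ> c) \<circ> f)"
      unfolding v_def u_def by (simp only: o_assoc)
    then have "e \<circ> c \<circ> f \<circ> s i = e \<circ> v i \<circ> c \<circ> f"
      unfolding d(2) comp_id g(2) ..
    also have "\<dots> = gf (tag j i) \<circ> (e \<circ> c \<circ> f)"
      unfolding e(2)[OF i] by (simp only: o_assoc)
    finally show "(e \<circ> c \<circ> f) \<circ> s i = gf (tag j i) \<circ> (e \<circ> c \<circ> f)" .
  qed
qed

text \<open>Sifting the images of the base leaves an element that fixes the base, for which
  \<open>stab\<close> gives at most 34 letters, all among 1 to 4.\<close>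

lemma words:
  assumes h: "h \<in> M" and "valid L Vs ns base []" "length Vs = 5" and L: "set L \<subseteq> {1..6}" "{1,2,3,4}
    \<subseteq> set L"
  obtains w where "set w \<subseteq> set L" "length w \<le> sum_list ns + 34" "h = wfun gf w"
proof -
  have xs: "length (map h base) = length Vs" "distinct (map h base)" "set (map h base) \<subseteq> {1..24} -
    set []"
    using assms(3) base_props M_inj[OF h] M_in[OF h] by (auto simp: distinct_map inj_on_def)
  obtain w where w: "set w \<subseteq> set L" "length w \<le> sum_list ns" "wfun gf w \<circ> down Vs (coords Vs (map h
    base)) = id"
    "down Vs (coords Vs (map h base)) \<in> M" "map (down Vs (coords Vs (map h base))) (map h base) =
      base"
    by (rule chain[OF assms(2) xs L(1)], blast)
  define d where "d = down Vs (coords Vs (map h base))"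
  have "map (d \<circ> h) base = map id base"
    using w(5) by (simp add: d_def)
  then have "(d \<circ> h) z = z" if "z \<in> set base" for z
    using that unfolding map_eq_conv by simp
  then obtain v where v: "d \<circ> h = wfun gf v" "length v \<le> 34" "set v \<subseteq> {1,2,3,4}"
    using stab[OF M_comp[OF w(4)[folded d_def] h]] by metis
  show ?thesis
  proof (rule that)
    show "set (w @ v) \<subseteq> set L" "length (w @ v) \<le> sum_list ns + 34"
      using w(1,2) v(2,3) L(2) by auto
    have "h = wfun gf w \<circ> d \<circ> h"
      using w(3) by (simp add: d_def)
    then show "h = wfun gf (w @ v)"
      unfolding wfun_append v(1)[symmetric] by (simp only: o_assoc)
  qed
qed

text \<open>Conjugation by \<open>c\<close> carries the string to the standard generators letter by
  letter, so a word for the conjugate of \<open>h\<close> is, up to renaming of letters, a word for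
  \<open>h\<close>. The bounds are 58 + 34 and 62 + 34.\<close>

lemma short_words:
  assumes s: "good j s" and j: "j \<in> {5,6}" and h: "h \<in> M"
  obtains w where "set w \<subseteq> {1..5}" "length w \<le> (if j = 5 then 92 else 96)" "h = wfun s w"
proof -
  obtain c where c: "c \<in> M" "\<And>i. i \<in> {1..5} \<Longrightarrow> c \<circ> s i = gf (tag j i) \<circ> c"
    by (rule classification[OF s j], blast)
  obtain d where d: "d \<in> M" "d \<circ> c = id" "c \<circ> d = id"
    using M_inverse[OF c(1)] .
  have hM: "c \<circ> h \<circ> d \<in> M"
    by (intro M_comp c h d)
  obtain w where w: "set w \<subseteq> tag j ` {1..5}" "length w \<le> (if j = 5 then 92 else 96)" "c \<circ> h \<circ> d =
    wfun gf w"
  proof (cases "j = 5")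
    case True
    have "set [1,2,3,4,5] \<subseteq> tag j ` {1..5}"
      using True by (auto simp: tag_def image_iff)
    moreover have "length Ws = 5" "set [1,2,3,4,5] \<subseteq> {1..6::nat}" "{1,2,3,4} \<subseteq> set [1,2,3,4,5::nat]"
      by (simp_all add: Ws_def)
    then obtain w where "set w \<subseteq> set [1,2,3,4,5]" "length w \<le> sum_list [7,18,5,13,15] + 34" "c \<circ> h \<circ>
      d = wfun gf w"
      by (rule words[OF hM valid_Ws], blast)
    ultimately show ?thesis
      using True by (intro that[of w]) auto
  next
    case False
    then have "j = 6" using j by simp
    then have "set [1,2,3,4,6] \<subseteq> tag j ` {1..5}"
      by (force simp: tag_def image_iff)
    moreover have "length Ws' = 5" "set [1,2,3,4,6] \<subseteq> {1..6::nat}" "{1,2,3,4} \<subseteq> set [1,2,3,4,6::nat]"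
      by (simp_all add: Ws'_def)
    then obtain w where "set w \<subseteq> set [1,2,3,4,6]" "length w \<le> sum_list [9,20,5,13,15] + 34" "c \<circ> h \<circ>
      d = wfun gf w"
      by (rule words[OF hM valid_Ws'], blast)
    ultimately show ?thesis
      using False by (intro that[of w]) auto
  qed
  obtain w' where w': "w = map (tag j) w'" "set w' \<subseteq> {1..5}"
  proof -
    have "\<exists>w'. w = map (tag j) w' \<and> set w' \<subseteq> {1..5}" if "set w \<subseteq> tag j ` {1..5}" for w
      using that
    proof (induction w)
      case (Cons k w)
      then obtain i w' where "k = tag j i" "i \<in> {1..5}" "w = map (tag j) w'" "set w' \<subseteq> {1..5}"
        by auto
      then show ?case
        by (intro exI[of _ "i # w'"]) simp
    qed simp
    then show ?thesis
      using that w(1) by blast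
  qed
  have "c \<circ> wfun s w' = wfun gf (map (tag j) w') \<circ> c"
    using w'(2)
  proof (induction w')
    case (Cons i w')
    have "c \<circ> wfun s (i # w') = (c \<circ> s i) \<circ> wfun s w'"
      by (simp only: wfun.simps o_assoc)
    also have "\<dots> = gf (tag j i) \<circ> (c \<circ> wfun s w')"
      using Cons.prems by (subst c(2)) (simp_all add: o_assoc)
    also have "c \<circ> wfun s w' = wfun gf (map (tag j) w') \<circ> c"
      using Cons.prems by (intro Cons.IH) simp
    finally show ?case
      by (simp only: wfun.simps list.map o_assoc)
  qed simp
  also have "\<dots> = c \<circ> h \<circ> (d \<circ> c)"
    unfolding w'(1)[symmetric] w(3)[symmetric] by (simp only: o_assoc)
  finally have "c \<circ> wfun s w' = c \<circ> h"
    unfolding d(2) comp_id .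
  then have "h = wfun s w'"
    using comp_cancel_left[OF d(2)] by metis
  then show ?thesis
    using that[OF w'(2)] w(2) w'(1) by simp
qed

section \<open>Chamber graphs\<close>

context group
begin

definition word_prod :: "(nat \<Rightarrow> 'a) \<Rightarrow> nat list \<Rightarrow> 'a" where
  "word_prod t w = foldr (\<lambda>i x. t i \<otimes> x) w \<one>"

lemma word_prod_simps [simp]:
  "word_prod t [] = \<one>" "word_prod t (i # w) = t i \<otimes> word_prod t w"
  by (simp_all add: word_prod_def)

lemma word_prod_closed: "(\<And>i. i \<in> set w \<Longrightarrow> t i \<in> carrier G) \<Longrightarrow> word_prod t w \<in> carrier G"
  by (induction w) auto

lemma word_prod_append:
  "(\<And>i. i \<in> set (v @ w) \<Longrightarrow> t i \<in> carrier G) \<Longrightarrow>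
    word_prod t (v @ w) = word_prod t v \<otimes> word_prod t w"
  by (induction v) (auto simp: m_assoc word_prod_closed)

lemma word_prod_replicate:
  assumes "\<And>i. i \<in> set v \<Longrightarrow> t i \<in> carrier G"
  shows "word_prod t (concat (replicate n v)) = word_prod t v [^] n"
proof (induction n)
  case (Suc n)
  have "word_prod t (v @ concat (replicate n v)) = word_prod t v \<otimes> word_prod t v [^] n"
    using assms by (subst word_prod_append) (auto simp: Suc)
  then show ?case
    using nat_pow_Suc2[OF word_prod_closed[of v t], of n] assms by simp
qed simp

lemma word_prod_generate: "set w \<subseteq> J \<Longrightarrow> word_prod t w \<in> generate G (t ` J)"
  by (induction w) (auto intro: generate.one generate.eng generate.incl)

lemma word_prod_iso:
  assumes "\<phi> \<in> hom G M24" "\<And>i. i \<in> set w \<Longrightarrow> t i \<in> carrier G"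
  shows "\<phi> (word_prod t w) = wfun (\<lambda>i. \<phi> (t i)) w"
  using assms(2)
proof (induction w)
  case Nil
  then show ?case
    using hom_one[OF assms(1) is_group group_M24] by simp
next
  case (Cons i w)
  then show ?case
    using hom_mult[OF assms(1), of "t i" "word_prod t w"] by (simp add: word_prod_closed)
qed

lemma C_string_good:
  assumes C: "C_string G 5 t" and \<phi>: "\<phi> \<in> iso G M24"
    and S: "schlaefli_symbol G 5 t = [4, 10, 3, m]" and m: "m = (if j = 5 then 4 else 3)"
  shows "good j (\<lambda>i. \<phi> (t i))"
proof -
  have t: "t i \<in> carrier G" "ord (t i) = 2" if "i \<in> {1..5}" for i
    using C that by (auto simp: C_string_def)
  have hom: "\<phi> \<in> hom G M24" and inj: "inj_on \<phi> (carrier G)"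
    using \<phi> by (auto simp: iso_def bij_betw_def)
  let ?p = "word_prod t"
  have eq: "wfun (\<lambda>i. \<phi> (t i)) w = wfun (\<lambda>i. \<phi> (t i)) v \<longleftrightarrow> ?p w = ?p v"
    if "set w \<union> set v \<subseteq> {1..5}" for w v
  proof -
    have "wfun (\<lambda>i. \<phi> (t i)) w = \<phi> (?p w)" "wfun (\<lambda>i. \<phi> (t i)) v = \<phi> (?p v)"
      using that t by (auto intro!: word_prod_iso[OF hom, symmetric])
    moreover have "?p w \<in> carrier G" "?p v \<in> carrier G"
      using that t by (auto intro!: word_prod_closed)
    ultimately show ?thesis
      using inj by (auto simp: inj_on_eq_iff)
  qed
  have ord: "ord (t 1 \<otimes> t 2) = 4" "ord (t 2 \<otimes> t 3) = 10" "ord (t 3 \<otimes> t 4) = 3" "ord (t 4 \<otimes> t 5) = m"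
    using S by (simp_all add: schlaefli_symbol_def upt_rec eval_nat_numeral)
  have pow: "?p (concat (replicate n [a, b])) = \<one> \<longleftrightarrow> ord (t a \<otimes> t b) dvd n"
    if "a \<in> {1..5}" "b \<in> {1..5}" for a b n
    using that t by (subst word_prod_replicate) (auto simp: pow_eq_id)
  have sq: "?p [i, i] = \<one>" if "i \<in> {1..5}" for i
    using pow_eq_id[OF t(1)[OF that], of 2] t[OF that] by (simp add: numeral_2_eq_2)
  have ne: "t i \<noteq> \<one>" if "i \<in> {1..5}" for i
    using t(2)[OF that] by (intro notI) simp
  have comm: "?p [i, k] = ?p [k, i]" if "i \<in> {1..5}" "k \<in> {1..5}" "i + 2 \<le> k" for i k
    using C that t by (auto simp: C_string_def)
  \<comment> \<open>The intersection property is applied to a single index and its complement: the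
    two subgroups meet trivially, while a generator is not trivial. This yields the inequations with
    \<open>word_a\<close>, \<open>word_b\<close> and \<open>word_c\<close>.\<close>
  have indep: "?p [i] \<noteq> ?p w" if i: "i \<in> {1..5}" and w: "set w \<subseteq> {1..5} - {i}" for i w
  proof
    assume "?p [i] = ?p w"
    moreover have "?p [i] \<in> generate G (t ` {i})" "?p w \<in> generate G (t ` ({1..5} - {i}))"
      using word_prod_generate[of "[i]" "{i}"] word_prod_generate[OF w] by auto
    ultimately have "?p [i] \<in> generate G (t ` {i}) \<inter> generate G (t ` ({1..5} - {i}))"
      by simp
    also have "\<dots> = generate G (t ` ({i} \<inter> ({1..5} - {i})))"
      using C i unfolding C_string_def by blast
    also have "\<dots> = {\<one>}"
      by (simp add: generate_empty)
    finally show False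
      using ne[OF i] t[OF i] by simp
  qed
  have "?p w = ?p v" if "(w, v) \<in> set common_rels" for w v
  proof -
    have "?p (concat (replicate 4 [1,2])) = ?p []" "?p (concat (replicate 10 [2,3])) = ?p []"
        "?p (concat (replicate 3 [3,4])) = ?p []"
      using pow ord by simp_all
    then show ?thesis
      using that sq[of 1] sq[of 2] sq[of 3] sq[of 4] sq[of 5] comm[of 1 3] comm[of 1 4] comm[of 1 5]
        comm[of 2 4] comm[of 2 5] comm[of 3 5]
      unfolding common_rels_def
      by (simp del: word_prod_simps(2) add: eval_nat_numeral) (elim disjE; simp del:
        word_prod_simps(2))
  qed
  moreover have "set w \<union> set v \<subseteq> {1..5}" if "(w, v) \<in> set common_rels" for w v
    using that by (auto simp: common_rels_def)
  ultimately have 1: "\<forall>(w, v)\<in>set common_rels. wfun (\<lambda>i. \<phi> (t i)) w = wfun (\<lambda>i. \<phi> (t i)) v"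
    using eq by blast
  have "?p (last_rel j) = ?p []"
    using pow[of 4 5 m] ord(4) unfolding m last_rel_def by (simp add: eval_nat_numeral split:
      if_splits)
  moreover have "set (last_rel j) \<union> set [] \<subseteq> {1..5}"
    by (auto simp: last_rel_def)
  ultimately have 2: "wfun (\<lambda>i. \<phi> (t i)) (last_rel j) = id"
    using eq[of "last_rel j" "[]"] by simp
  have "?p w \<noteq> ?p v" if "(w, v) \<in> set nonrels" for w v
  proof -
    have "?p (concat (replicate 2 [2,3])) \<noteq> ?p []" "?p (concat (replicate 5 [2,3])) \<noteq> ?p []"
        "?p (concat (replicate 2 [4,5])) \<noteq> ?p []"
      using pow ord m by (simp_all split: if_splits)
    moreover have "?p [1] \<noteq> ?p []" "?p [5] \<noteq> ?p []" "?p [5] \<noteq> ?p [2,3,2,3,2,3,2,3,2,3]"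
        "?p [5] \<noteq> ?p word_a" "?p [5] \<noteq> ?p word_b" "?p [1] \<noteq> ?p word_c"
      by (rule indep; force simp: word_a_def word_b_def word_c_def)+
    ultimately show ?thesis
      using that unfolding nonrels_def
      by (simp del: word_prod_simps(2) add: eval_nat_numeral) (elim disjE; simp del:
        word_prod_simps(2))
  qed
  moreover have "set w \<union> set v \<subseteq> {1..5}" if "(w, v) \<in> set nonrels" for w v
    using that by (auto simp: nonrels_def word_a_def word_b_def word_c_def)
  ultimately have 3: "\<forall>(w, v)\<in>set nonrels. wfun (\<lambda>i. \<phi> (t i)) w \<noteq> wfun (\<lambda>i. \<phi> (t i)) v"
    using eq by blast
  have "\<forall>i\<in>{1..5}. \<phi> (t i) \<in> M"
    using t hom by (auto simp: hom_def)
  then show ?thesis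
    unfolding good_def using 1 2 3 by blast
qed

text \<open>Arcs multiply on the right, so the letters of a word are read from left to right along
  the walk.\<close>

lemma chamber_walk:
  assumes C: "C_string G n t" and u: "u \<in> carrier G" and w: "set w \<subseteq> {1..n}"
  shows "\<exists>p. pre_digraph.awalk (with_proj (chamber_graph G n t)) u p (u \<otimes> word_prod t w) \<and> length p
    = length w"
  using u w
proof (induction w arbitrary: u)
  interpret D: wf_digraph "with_proj (chamber_graph G n t)"
    using C by (rule wf_digraph_chamber_graph)
  case Nil
  then have "u \<in> verts (with_proj (chamber_graph G n t))"
    by (simp add: chamber_graph_def cayley_graph_def)
  then have "D.awalk u [] (u \<otimes> word_prod t [])"
    using Nil by (simp add: D.awalk_Nil_iff)
  then show ?case by auto
next
  interpret D: wf_digraph "with_proj (chamber_graph G n t)"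
    using C by (rule wf_digraph_chamber_graph)
  case (Cons i w)
  have t: "t k \<in> carrier G" if "k \<in> {1..n}" for k
    using C that by (auto simp: C_string_def)
  have i: "i \<in> {1..n}" "set w \<subseteq> {1..n}"
    using Cons.prems by auto
  obtain p where p: "D.awalk (u \<otimes> t i) p (u \<otimes> t i \<otimes> word_prod t w)" "length p = length w"
    using Cons.IH[OF m_closed[OF Cons.prems(1) t[OF i(1)]] i(2)] by blast
  have "word_prod t w \<in> carrier G"
    using i t by (auto intro!: word_prod_closed)
  then have "u \<otimes> t i \<otimes> word_prod t w = u \<otimes> word_prod t (i # w)"
    using Cons.prems(1) t[OF i(1)] by (simp add: m_assoc)
  moreover have "(u, u \<otimes> t i) \<in> parcs (chamber_graph G n t)"
    using Cons.prems(1) i(1) by (auto simp: chamber_graph_def cayley_graph_def)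
  ultimately have "D.awalk u ((u, u \<otimes> t i) # p) (u \<otimes> word_prod t (i # w))"
    using p(1) by (simp add: D.awalk_Cons_iff)
  then show ?case
    using p(2) by (intro exI[of _ "(u, u \<otimes> t i) # p"]) simp
qed

lemma diameter_chamber_graph:
  assumes C: "C_string G n t"
    and short: "\<And>h. h \<in> carrier G \<Longrightarrow> \<exists>w. set w \<subseteq> {1..n} \<and> length w \<le> N \<and> h = word_prod t w"
  shows "diameter (with_proj (chamber_graph G n t)) \<le> N"
  unfolding diameter_def
proof (intro SUP_least)
  interpret D: wf_digraph "with_proj (chamber_graph G n t)"
    using C by (rule wf_digraph_chamber_graph)
  fix u v
  assume "u \<in> verts (with_proj (chamber_graph G n t))" "v \<in> verts (with_proj (chamber_graph G n t))"
  then have uv: "u \<in> carrier G" "v \<in> carrier G"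
    by (auto simp: chamber_graph_def cayley_graph_def)
  \<comment> \<open>Left translation preserves the graph, so the distance from \<open>u\<close> to
    \<open>v\<close> is governed by a word for \<open>inv u \<otimes> v\<close>.\<close>
  obtain w where w: "set w \<subseteq> {1..n}" "length w \<le> N" "inv u \<otimes> v = word_prod t w"
    using short[of "inv u \<otimes> v"] uv by auto
  have "u \<otimes> word_prod t w = v"
    using uv by (simp flip: w(3) m_assoc)
  then obtain p where p: "D.awalk u p v" "length p = length w"
    using chamber_walk[OF C uv(1) w(1)] by auto
  have "D.awalk_cost (\<lambda>_. 1) p = length p"
    by (simp add: D.awalk_cost_def sum_list_triv)
  then have "D.\<mu> (\<lambda>_. 1) u v \<le> ereal (length p)"
    using D.min_cost_le_walk_cost[OF p(1), of "\<lambda>_. 1"] by simp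
  also have "\<dots> \<le> N"
    using p(2) w(2) by simp
  finally show "D.\<mu> (\<lambda>_. 1) u v \<le> N" .
qed

lemma diameter_bound:
  assumes iso: "G \<cong> M24" and C: "C_string G 5 t"
    and S: "schlaefli_symbol G 5 t = [4, 10, 3, m]" and m: "m = (if j = 5 then 4 else 3)" and j: "j
      \<in> {5,6::nat}"
  shows "diameter (with_proj (chamber_graph G 5 t)) \<le> (if j = 5 then 92 else 96 :: nat)"
proof (rule diameter_chamber_graph[OF C])
  fix h assume h: "h \<in> carrier G"
  obtain \<phi> where \<phi>: "\<phi> \<in> iso G M24"
    using iso by (auto simp: is_iso_def)
  then have hom: "\<phi> \<in> hom G M24" and inj: "inj_on \<phi> (carrier G)"
    by (auto simp: iso_def bij_betw_def)
  have t: "t i \<in> carrier G" if "i \<in> {1..5}" for i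
    using C that by (auto simp: C_string_def)
  obtain w where w: "set w \<subseteq> {1..5}" "length w \<le> (if j = 5 then 92 else 96)" "\<phi> h = wfun (\<lambda>i. \<phi> (t
    i)) w"
    using short_words[OF C_string_good[OF C \<phi> S m] j, of "\<phi> h"] hom h by (auto simp: hom_def)
  have "\<phi> h = \<phi> (word_prod t w)"
    using w t by (subst word_prod_iso[OF hom]) auto
  then have "h = word_prod t w"
    using inj h w(1) t by (auto simp: inj_on_eq_iff word_prod_closed subset_iff)
  then show "\<exists>w. set w \<subseteq> {1..5} \<and> length w \<le> (if j = 5 then 92 else 96) \<and> h = word_prod t w"
    using w by blast
qed

end

theorem theorem1p1:
  fixes G :: "('a, 'b) monoid_scheme" and t :: "nat \<Rightarrow> 'a"
  assumes "group G" and "G \<cong> M24" and "C_string G 5 t"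
  shows "(schlaefli_symbol G 5 t = [4, 10, 3, 4] \<longrightarrow>
           diameter (with_proj (chamber_graph G 5 t)) \<le> 127) \<and>
         (schlaefli_symbol G 5 t = [4, 10, 3, 3] \<longrightarrow>
           diameter (with_proj (chamber_graph G 5 t)) \<le> 133)"
proof (intro conjI impI)
  assume "schlaefli_symbol G 5 t = [4, 10, 3, 4]"
  then have "diameter (with_proj (chamber_graph G 5 t)) \<le> (92 :: nat)"
    using group.diameter_bound[OF assms, of 4 5] by simp
  also have "ereal (92 :: nat) \<le> 127"
    by simp
  finally show "diameter (with_proj (chamber_graph G 5 t)) \<le> 127" .
next
  assume "schlaefli_symbol G 5 t = [4, 10, 3, 3]"
  then have "diameter (with_proj (chamber_graph G 5 t)) \<le> (96 :: nat)"
    using group.diameter_bound[OF assms, of 3 6] by simp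
  also have "ereal (96 :: nat) \<le> 133"
    by simp
  finally show "diameter (with_proj (chamber_graph G 5 t)) \<le> 133" .
qed

end
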